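(* Let $p$ be a prime and let $G$ be a finite abelian $p$-group with a chosen long presentation and associated composition series $\{1\}=G_0<G_1<\dots<G_N=G$. Let $0\le l\le N$ and let $e$ be a non-trivial primitive central idempotent of $\mathbb{Q}[G_l]$. Then $e$ can be expressed as a product containing exactly one factor of the form $e'_z$, where $z$ is a generator of the chosen long presentation lying in $G_l$, all the other factors being of the form $e_x$ with $x\in G_l$.
   Context: For $x\in G$, $e_x=\frac{1+x+\cdots+x^{p-1}}{p}\in\mathbb{Q}[G]$ and $e'_x=1-e_x$. Long presentation: write $G=\prod_{i=1}^m\prod_{j=1}^{l_i}C_{p^{r_i},j}$ with $r_1>r_2>\dots>r_m\ge1$, where $C_{p^{r_i},j}$ is the $j$-th of $l_i$ cyclic factors of order $p^{r_i}$. Each factor $C_{p^{r_i},j}$ is given long generators $x_{\{(r_i,j),a\}}$, $1\le a\le r_i$, with $x_{\{(r_i,j),r_i\}}$ generating the factor, $x_{\{(r_i,j),a\}}^p=x_{\{(r_i,j),a-1\}}$ for $a\ge2$, and $x_{\{(r_i,j),1\}}^p=1$. The long presentation of $G$ consists of all these generators and relations together with commutativity. The composition series is obtained by introducing the long generators one at a time, $G_{k}$ being the subgroup generated by the first $k$ of them; the cyclic factors are taken one after another with $i$ increasing and, for fixed $i$, $j$ decreasing, and within a factor the generators are introduced with $a$ increasing. So $|G_k|=p^k$ and $|G|=p^N$. The trivial primitive central idempotent of $\mathbb{Q}[G_l]$ is $\frac{1}{|G_l|}\sum_{g\in G_l}g$; a primitive central idempotent is non-trivial if it differs from this one. *)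

theory Defs
  imports
    "HOL-Algebra.Product_Groups"
    "HOL-Algebra.Ring"
    "HOL-Computational_Algebra.Primes"
begin

section \<open>Primitive central idempotents\<close>

definition central_idempotent :: "('a, 'b) ring_scheme \<Rightarrow> 'a \<Rightarrow> bool" where
  "central_idempotent R e \<longleftrightarrow>
     e \<in> carrier R \<and> e \<otimes>\<^bsub>R\<^esub> e = e \<and> (\<forall>a\<in>carrier R. e \<otimes>\<^bsub>R\<^esub> a = a \<otimes>\<^bsub>R\<^esub> e)"

definition primitive_central_idempotent :: "('a, 'b) ring_scheme \<Rightarrow> 'a \<Rightarrow> bool" where
  "primitive_central_idempotent R e \<longleftrightarrow>
     central_idempotent R e \<and> e \<noteq> \<zero>\<^bsub>R\<^esub> \<and>
     \<not> (\<exists>f g. central_idempotent R f \<and> central_idempotent R g \<and>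
              f \<noteq> \<zero>\<^bsub>R\<^esub> \<and> g \<noteq> \<zero>\<^bsub>R\<^esub> \<and> f \<otimes>\<^bsub>R\<^esub> g = \<zero>\<^bsub>R\<^esub> \<and> e = f \<oplus>\<^bsub>R\<^esub> g)"


section \<open>The rational group algebra\<close>

text \<open>
  An element of \<open>\<rat>[G]\<close> is its coefficient function, extended by zero outside \<open>carrier G\<close>.
  Hence for a subgroup \<open>H\<close> of \<open>G\<close>, the algebra of \<open>G\<lparr>carrier := H\<rparr>\<close> is literally
  a subring of that of \<open>G\<close>, with the same operations.
\<close>

definition group_basis :: "'a \<Rightarrow> 'a \<Rightarrow> rat" where
  "group_basis g = (\<lambda>h. if h = g then 1 else 0)"

definition rat_group_algebra :: "('a, 'b) monoid_scheme \<Rightarrow> ('a \<Rightarrow> rat) ring" where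
  "rat_group_algebra G =
     \<lparr>carrier = {f. finite {g. f g \<noteq> 0} \<and> {g. f g \<noteq> 0} \<subseteq> carrier G},
      monoid.mult = (\<lambda>f h g. \<Sum>(a, b)\<in>{(a, b). f a \<noteq> 0 \<and> h b \<noteq> 0 \<and> a \<otimes>\<^bsub>G\<^esub> b = g}. f a * h b),
      one = group_basis \<one>\<^bsub>G\<^esub>,
      zero = (\<lambda>g. 0),
      add = (\<lambda>f h g. f g + h g)\<rparr>"

text \<open>The trivial primitive central idempotent of \<open>\<rat>[H]\<close>, for a finite subgroup \<open>H\<close>.\<close>

definition trivial_idempotent :: "'a set \<Rightarrow> 'a \<Rightarrow> rat" where
  "trivial_idempotent H = (\<lambda>h. (\<Sum>g\<in>H. group_basis g h) / of_nat (card H))"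

text \<open>
  \<open>e_elem G p x\<close> is \<open>(1 + x + \<dots> + x\<^sup>p\<^sup>-\<^sup>1) / p\<close>, for arbitrary \<open>x\<close>; the powers of \<open>x\<close> are
  counted with multiplicity, so it is \<open>1\<close> when \<open>x = \<one>\<close>, and it need not be idempotent
  when the order of \<open>x\<close> exceeds \<open>p\<close>.
\<close>

definition e_elem :: "('a, 'b) monoid_scheme \<Rightarrow> nat \<Rightarrow> 'a \<Rightarrow> 'a \<Rightarrow> rat" where
  "e_elem G p x = (\<lambda>g. (\<Sum>k<p. group_basis (x [^]\<^bsub>G\<^esub> k) g) / of_nat p)"

definition e'_elem :: "('a, 'b) monoid_scheme \<Rightarrow> nat \<Rightarrow> 'a \<Rightarrow> 'a \<Rightarrow> rat" where
  "e'_elem G p x =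
     \<one>\<^bsub>rat_group_algebra G\<^esub> \<ominus>\<^bsub>rat_group_algebra G\<^esub> e_elem G p x"

definition list_product :: "('a, 'b) monoid_scheme \<Rightarrow> 'a list \<Rightarrow> 'a" where
  "list_product M us = foldr (\<lambda>u v. u \<otimes>\<^bsub>M\<^esub> v) us \<one>\<^bsub>M\<^esub>"


section \<open>Long presentations\<close>

text \<open>
  \<open>s i\<close> is the number of cyclic factors of order \<open>p ^ r i\<close>, and \<open>x i j a\<close> is the long
  generator \<open>x\<^bsub>{(r\<^sub>i,j),a}\<^esub>\<close>; since \<open>r\<close> is strictly decreasing, indexing by \<open>i\<close> is the same
  as indexing by \<open>r i\<close>. Values outside the index ranges are irrelevant.
\<close>

locale long_presentation = comm_group G
  for G (structure) and p m :: nat and r s :: "nat \<Rightarrow> nat"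
    and x :: "nat \<Rightarrow> nat \<Rightarrow> nat \<Rightarrow> 'a" +
  assumes r_decreasing: "strict_antimono_on {1..m} r"
    and r_pos: "i \<in> {1..m} \<Longrightarrow> 1 \<le> r i"
    and s_pos: "i \<in> {1..m} \<Longrightarrow> 1 \<le> s i"
    and gen_closed: "\<lbrakk>i \<in> {1..m}; j \<in> {1..s i}; a \<in> {1..r i}\<rbrakk> \<Longrightarrow> x i j a \<in> carrier G"
    and gen_step: "\<lbrakk>i \<in> {1..m}; j \<in> {1..s i}; a \<in> {2..r i}\<rbrakk> \<Longrightarrow> x i j a [^] p = x i j (a - 1)"
    and gen_bottom: "\<lbrakk>i \<in> {1..m}; j \<in> {1..s i}\<rbrakk> \<Longrightarrow> x i j 1 [^] p = \<one>"
    and factor_card: "\<lbrakk>i \<in> {1..m}; j \<in> {1..s i}\<rbrakk> \<Longrightarrow> card (generate G {x i j (r i)}) = p ^ r i"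
    and direct_product:
      "(\<lambda>h. \<Otimes>k\<in>(SIGMA i:{1..m}. {1..s i}). h k)
         \<in> iso (product_group (SIGMA i:{1..m}. {1..s i})
                  (\<lambda>(i, j). subgroup_generated G {x i j (r i)})) G"

text \<open>
  The long generators in the order in which they are introduced:
  \<open>i\<close> increasing, then \<open>j\<close> decreasing, then \<open>a\<close> increasing.
\<close>

definition long_generators ::
  "nat \<Rightarrow> (nat \<Rightarrow> nat) \<Rightarrow> (nat \<Rightarrow> nat) \<Rightarrow> (nat \<Rightarrow> nat \<Rightarrow> nat \<Rightarrow> 'a) \<Rightarrow> 'a list" where
  "long_generators m r s x =
     [x i j a. i \<leftarrow> [1..<m + 1], j \<leftarrow> rev [1..<s i + 1], a \<leftarrow> [1..<r i + 1]]"

text \<open>\<open>series_subgroup G gs k\<close> is the \<open>k\<close>-th member \<open>G\<^sub>k\<close> of the series obtained from the list \<open>gs\<close>.\<close>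

definition series_subgroup :: "('a, 'b) monoid_scheme \<Rightarrow> 'a list \<Rightarrow> nat \<Rightarrow> 'a set" where
  "series_subgroup G gs k = generate G (set (take k gs))"

end

theory Submission
  imports Defs "HOL-Number_Theory.Residues"
begin

text \<open>
  Write \<open>H = G\<^sub>l\<close> and let \<open>K\<close> be the subgroup of those \<open>y \<in> H\<close> with \<open>y e = e\<close>. Since \<open>e\<close> is
  non-trivial, \<open>K \<noteq> H\<close>, so some long generator \<open>z\<close> in \<open>H\<close> satisfies \<open>z \<notin> K\<close> and \<open>z\<^sup>p \<in> K\<close>. The
  idempotent of \<open>K\<close> is a product of elements \<open>e\<^sub>x\<close> with \<open>x \<in> K\<close>, and \<open>e\<close> is that idempotent
  times \<open>e'\<^sub>z\<close>. Primitivity gives \<open>e e\<^sub>y = 0\<close> for every \<open>y \<notin> K\<close> with \<open>y\<^sup>p \<in> K\<close>, which forces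
  \<open>H/K\<close> to have a single subgroup of order \<open>p\<close>, generated by \<open>z\<close>.

  Irreducibility of the cyclotomic polynomials is replaced by the fact that the coefficients of
  any idempotent satisfy \<open>e(g\<^sup>k) = e(g)\<close> for \<open>k\<close> prime to \<open>p\<close>: for a prime \<open>q \<noteq> p\<close> comparing
  \<open>e\<^sup>q = e\<close> with the Frobenius map modulo \<open>q\<close> gives \<open>e(g\<^sup>q) \<equiv> e(g)\<close>, hence equality when \<open>q\<close> is
  large, and every \<open>k\<close> prime to \<open>p\<close> is congruent modulo \<open>|G|\<close> to a product of large primes.
\<close>

section \<open>The group algebra of a finite abelian group\<close>

locale finite_comm_group = comm_group G for G (structure) +
  assumes finite_carrier: "finite (carrier G)"
begin

abbreviation QG ("\<rat>G") where "\<rat>G \<equiv> rat_group_algebra G"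

abbreviation conv (infixl "\<star>" 70) where "f \<star> h \<equiv> f \<otimes>\<^bsub>\<rat>G\<^esub> h"

text \<open>The finite-support condition is automatic because \<open>G\<close> is finite.\<close>

lemma mem_QG_iff: "f \<in> carrier \<rat>G \<longleftrightarrow> (\<forall>g. g \<notin> carrier G \<longrightarrow> f g = 0)"
proof
  assume "\<forall>g. g \<notin> carrier G \<longrightarrow> f g = 0"
  then have "{g. f g \<noteq> 0} \<subseteq> carrier G"
    by auto
  then show "f \<in> carrier \<rat>G"
    using finite_subset[OF _ finite_carrier] by (simp add: rat_group_algebra_def)
qed (auto simp: rat_group_algebra_def)

lemma QG_outside: "f \<in> carrier \<rat>G \<Longrightarrow> g \<notin> carrier G \<Longrightarrow> f g = 0"
  by (simp add: mem_QG_iff)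

lemma add_apply: "(f \<oplus>\<^bsub>\<rat>G\<^esub> h) g = f g + h g"
  and zero_apply: "\<zero>\<^bsub>\<rat>G\<^esub> g = 0"
  and one_eq: "\<one>\<^bsub>\<rat>G\<^esub> = group_basis \<one>"
  by (simp_all add: rat_group_algebra_def)

lemma basis_mem: "y \<in> carrier G \<Longrightarrow> group_basis y \<in> carrier \<rat>G"
  by (auto simp: mem_QG_iff group_basis_def)

text \<open>In a pair \<open>(a, b)\<close> with product \<open>g\<close>, \<open>b\<close>
  determines \<open>a\<close>, so the sum over pairs becomes a sum over \<open>b\<close>; all later
  computations use this form.\<close>

lemma conv_apply:
  assumes f: "f \<in> carrier \<rat>G" and h: "h \<in> carrier \<rat>G" and g: "g \<in> carrier G"
  shows "(f \<star> h) g = (\<Sum>b\<in>carrier G. f (g \<otimes> inv b) * h b)"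
proof -
  have "(f \<star> h) g = (\<Sum>(a, b)\<in>{(a, b). f a \<noteq> 0 \<and> h b \<noteq> 0 \<and> a \<otimes> b = g}. f a * h b)"
    by (simp add: rat_group_algebra_def)
  also have "\<dots> = (\<Sum>b\<in>{b \<in> carrier G. f (g \<otimes> inv b) \<noteq> 0 \<and> h b \<noteq> 0}. f (g \<otimes> inv b) * h b)"
  proof (rule sum.reindex_bij_witness[where i = "\<lambda>b. (g \<otimes> inv b, b)" and j = snd])
    fix ab assume "ab \<in> {(a, b). f a \<noteq> 0 \<and> h b \<noteq> 0 \<and> a \<otimes> b = g}"
    then obtain a b where ab: "ab = (a, b)" "f a \<noteq> 0" "h b \<noteq> 0" "a \<otimes> b = g"
      by auto
    have c: "a \<in> carrier G" "b \<in> carrier G"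
      using QG_outside[OF f] QG_outside[OF h] ab by auto
    then have "g \<otimes> inv b = a"
      using ab(4) by (auto simp: m_assoc)
    with ab c show "(g \<otimes> inv snd ab, snd ab) = ab"
      "snd ab \<in> {b \<in> carrier G. f (g \<otimes> inv b) \<noteq> 0 \<and> h b \<noteq> 0}"
      "f (g \<otimes> inv snd ab) * h (snd ab) = (case ab of (a, b) \<Rightarrow> f a * h b)"
      by auto
  qed (use g in \<open>auto simp: m_assoc\<close>)
  \<comment> \<open>The excluded indices contribute zero terms, so the sum may run over the whole
    group.\<close>
  also have "\<dots> = (\<Sum>b\<in>carrier G. f (g \<otimes> inv b) * h b)"
    by (rule sum.mono_neutral_left) (use finite_carrier in auto)
  finally show ?thesis .
qed

lemma conv_outside:
  assumes f: "f \<in> carrier \<rat>G" and h: "h \<in> carrier \<rat>G" and g: "g \<notin> carrier G"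
  shows "(f \<star> h) g = 0"
proof -
  have "{(a, b). f a \<noteq> 0 \<and> h b \<noteq> 0 \<and> a \<otimes> b = g} = {}"
    using QG_outside[OF f] QG_outside[OF h] g by fastforce
  then show ?thesis
    unfolding rat_group_algebra_def by (simp only: monoid.simps sum.empty)
qed

lemma QG_eqI:
  assumes "f \<in> carrier \<rat>G" "h \<in> carrier \<rat>G" "\<And>g. g \<in> carrier G \<Longrightarrow> f g = h g"
  shows "f = h"
  using assms by (metis QG_outside ext)

lemma conv_mem: "f \<in> carrier \<rat>G \<Longrightarrow> h \<in> carrier \<rat>G \<Longrightarrow> f \<star> h \<in> carrier \<rat>G"
  by (auto simp: mem_QG_iff[of "f \<star> h"] conv_outside)

text \<open>A group element acts on coefficient functions by translation: only the term
  \<open>b = g \<otimes> inv y\<close> survives.\<close>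

lemma basis_conv:
  assumes y: "y \<in> carrier G" and f: "f \<in> carrier \<rat>G" and g: "g \<in> carrier G"
  shows "(group_basis y \<star> f) g = f (g \<otimes> inv y)"
proof -
  have "(group_basis y \<star> f) g = (\<Sum>b\<in>carrier G. if b = g \<otimes> inv y then f b else 0)"
    unfolding conv_apply[OF basis_mem[OF y] f g]
  proof (rule sum.cong[OF refl])
    fix b assume b: "b \<in> carrier G"
    have "g \<otimes> inv b = y \<longleftrightarrow> b = g \<otimes> inv y"
      using b g y by (metis inv_closed inv_solve_right' m_comm)
    then show "group_basis y (g \<otimes> inv b) * f b = (if b = g \<otimes> inv y then f b else 0)"
      by (simp add: group_basis_def)
  qed
  also have "\<dots> = f (g \<otimes> inv y)"
    using finite_carrier y g by simp
  finally show ?thesis .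
qed

text \<open>The map sending \<open>b\<close> to \<open>g \<otimes> inv b\<close> is an involution;
  reindexing along it makes the convolution commutative.\<close>

lemma div_div_cancel:
  assumes "g \<in> carrier G" "b \<in> carrier G"
  shows "g \<otimes> inv (g \<otimes> inv b) = b"
  using assms by (metis inv_closed inv_solve_right' m_closed m_comm)

lemma div_div_cancel_right:
  assumes "g \<in> carrier G" "b \<in> carrier G" "c \<in> carrier G"
  shows "g \<otimes> inv c \<otimes> inv (b \<otimes> inv c) = g \<otimes> inv b"
proof -
  have "inv (b \<otimes> inv c) = c \<otimes> inv b"
    using assms by (simp add: inv_mult_group)
  then show ?thesis
    using assms by (simp add: m_assoc inv_solve_left')
qed

lemma conv_comm:
  assumes f: "f \<in> carrier \<rat>G" and h: "h \<in> carrier \<rat>G"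
  shows "f \<star> h = h \<star> f"
proof (rule QG_eqI)
  fix g assume g: "g \<in> carrier G"
  have "(\<Sum>b\<in>carrier G. f (g \<otimes> inv b) * h b) = (\<Sum>b\<in>carrier G. h (g \<otimes> inv b) * f b)"
    by (rule sum.reindex_bij_witness[where i = "\<lambda>b. g \<otimes> inv b" and j = "\<lambda>b. g \<otimes> inv b"])
      (use g in \<open>simp_all add: div_div_cancel mult.commute\<close>)
  then show "(f \<star> h) g = (h \<star> f) g"
    using f h g by (simp add: conv_apply)
qed (use f h in \<open>auto intro: conv_mem\<close>)

lemma conv_assoc:
  assumes f: "f \<in> carrier \<rat>G" and h: "h \<in> carrier \<rat>G" and k: "k \<in> carrier \<rat>G"
  shows "f \<star> h \<star> k = f \<star> (h \<star> k)"
proof (rule QG_eqI)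
  fix g assume g: "g \<in> carrier G"
  have "(f \<star> (h \<star> k)) g = (\<Sum>b\<in>carrier G. \<Sum>c\<in>carrier G. f (g \<otimes> inv b) * (h (b \<otimes> inv c) * k c))"
    using f h k g by (simp add: conv_apply conv_mem sum_distrib_left)
  also have "\<dots> = (\<Sum>c\<in>carrier G. \<Sum>b\<in>carrier G. f (g \<otimes> inv b) * (h (b \<otimes> inv c) * k c))"
    by (rule sum.swap)
  also have "\<dots> = (\<Sum>c\<in>carrier G. \<Sum>b\<in>carrier G. f (g \<otimes> inv c \<otimes> inv b) * h b * k c)"
  proof (rule sum.cong[OF refl])
    fix c assume c: "c \<in> carrier G"
    show "(\<Sum>b\<in>carrier G. f (g \<otimes> inv b) * (h (b \<otimes> inv c) * k c)) =
      (\<Sum>b\<in>carrier G. f (g \<otimes> inv c \<otimes> inv b) * h b * k c)"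
      by (rule sum.reindex_bij_witness[where i = "\<lambda>b. b \<otimes> c" and j = "\<lambda>b. b \<otimes> inv c"])
        (use g c in \<open>simp_all add: div_div_cancel_right\<close>, simp_all add: m_assoc)
  qed
  also have "\<dots> = (f \<star> h \<star> k) g"
    using f h k g by (simp add: conv_apply conv_mem sum_distrib_right)
  finally show "(f \<star> h \<star> k) g = (f \<star> (h \<star> k)) g" ..
qed (use f h k in \<open>auto intro: conv_mem\<close>)

lemma cring_QG: "cring \<rat>G"
proof (rule cringI)
  show "abelian_group \<rat>G"
  proof (rule abelian_groupI)
    fix f assume "f \<in> carrier \<rat>G"
    then show "\<exists>h\<in>carrier \<rat>G. h \<oplus>\<^bsub>\<rat>G\<^esub> f = \<zero>\<^bsub>\<rat>G\<^esub>"
      by (intro bexI[of _ "\<lambda>g. - f g"]) (auto simp: mem_QG_iff add_apply zero_apply)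
  qed (auto simp: mem_QG_iff add_apply zero_apply)
  show "comm_monoid \<rat>G"
  proof (rule comm_monoidI)
    fix f assume f: "f \<in> carrier \<rat>G"
    show "\<one>\<^bsub>\<rat>G\<^esub> \<star> f = f"
      by (rule QG_eqI) (use f in \<open>auto simp: one_eq basis_conv intro!: conv_mem basis_mem\<close>)
  qed (auto simp: conv_mem conv_assoc one_eq basis_mem intro: conv_comm)
next
  fix f h k assume *: "f \<in> carrier \<rat>G" "h \<in> carrier \<rat>G" "k \<in> carrier \<rat>G"
  then have a: "f \<oplus>\<^bsub>\<rat>G\<^esub> h \<in> carrier \<rat>G"
    by (auto simp: mem_QG_iff add_apply)
  have b: "f \<star> k \<oplus>\<^bsub>\<rat>G\<^esub> h \<star> k \<in> carrier \<rat>G"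
    using conv_mem[of f k] conv_mem[of h k] * by (auto simp: mem_QG_iff add_apply)
  show "(f \<oplus>\<^bsub>\<rat>G\<^esub> h) \<star> k = f \<star> k \<oplus>\<^bsub>\<rat>G\<^esub> h \<star> k"
    by (rule QG_eqI)
      (use * a b in \<open>auto simp: conv_apply add_apply conv_mem ring_distribs sum.distrib\<close>)
qed

end

sublocale finite_comm_group \<subseteq> QG: cring "rat_group_algebra G"
  by (rule cring_QG)

context finite_comm_group
begin

lemma minus_apply:
  assumes f: "f \<in> carrier \<rat>G" and h: "h \<in> carrier \<rat>G"
  shows "(f \<ominus>\<^bsub>\<rat>G\<^esub> h) g = f g - h g"
proof -
  have "(f \<ominus>\<^bsub>\<rat>G\<^esub> h) \<oplus>\<^bsub>\<rat>G\<^esub> h = f"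
    using f h by algebra
  then have "(f \<ominus>\<^bsub>\<rat>G\<^esub> h) g + h g = f g"
    by (metis add_apply)
  then show ?thesis
    by simp
qed

end

section \<open>Frobenius congruences for idempotents\<close>

text \<open>Fermat's little theorem for integers of either sign, obtained by passing to the natural
  residue \<open>c\<close> of \<open>a\<close>.\<close>

lemma prime_dvd_pow_diff_self:
  assumes q: "prime (q::nat)"
  shows "int q dvd a ^ q - a"
proof -
  define c where "c = nat (a mod int q)"
  have q0: "q > 0"
    using q by (simp add: prime_gt_0_nat)
  have c: "[a = int c] (mod int q)"
    using q0 by (simp add: c_def cong_def)
  have "[c ^ q = c] (mod q)"
  proof (cases "q dvd c")
    case True
    then show ?thesis
      using q0 by (simp add: cong_def mod_eq_0_iff_dvd dvd_power_le[of q c 1 q] dvd_imp_mod_0)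
        (metis dvd_power dvd_trans mod_eq_0_iff_dvd)
  next
    case False
    have "[c ^ (q - 1) * c = 1 * c] (mod q)"
      by (rule cong_scalar_right) (use fermat_theorem[OF q False] in simp)
    then show ?thesis
      using q0 by (metis mult.commute mult_1 power_eq_if not_gr_zero)
  qed
  then have "[int c ^ q = int c] (mod int q)"
    by (metis cong_int_iff of_nat_power)
  then have "[a ^ q = a] (mod int q)"
    by (metis c cong_pow cong_sym cong_trans)
  then show ?thesis
    by (simp add: cong_iff_dvd_diff)
qed

text \<open>Multiply the denominators together, one element of \<open>S\<close> at a time.\<close>

lemma finite_common_denominator:
  fixes f :: "'b \<Rightarrow> rat"
  assumes "finite S"
  shows "\<exists>D::nat. 0 < D \<and> (\<forall>s\<in>S. of_nat D * f s \<in> \<int>)"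
  using assms
proof (induction S)
  case (insert s S)
  then obtain D :: nat where D: "0 < D" "\<And>t. t \<in> S \<Longrightarrow> of_nat D * f t \<in> \<int>"
    by auto
  obtain a b where ab: "quotient_of (f s) = (a, b)"
    by fastforce
  then have b: "b > 0" "f s = of_int a / of_int b"
    by (auto dest: quotient_of_denom_pos quotient_of_div)
  then have "of_nat (nat b) * f s = of_int a"
    by simp
  then have 1: "of_nat (nat b * D) * f s \<in> \<int>"
    by (metis Ints_mult Ints_of_int Ints_of_nat mult.commute mult.left_commute of_nat_mult)
  have 2: "of_nat (nat b * D) * f t \<in> \<int>" if "t \<in> S" for t
    using D(2)[OF that] by (metis Ints_mult Ints_of_nat mult.assoc of_nat_mult)
  show ?case
    using 1 2 b D(1) by (intro exI[of _ "nat b * D"]) auto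
qed (auto intro: exI[of _ 1])

context finite_comm_group
begin

section \<open>Scalar multiples and finite sums in the group algebra\<close>

lemma conv_scale_left:
  assumes "f \<in> carrier \<rat>G" "h \<in> carrier \<rat>G"
  shows "(\<lambda>g. c * f g) \<star> h = (\<lambda>g. c * (f \<star> h) g)"
proof (rule QG_eqI)
  have m: "(\<lambda>g. c * f g) \<in> carrier \<rat>G"
    using assms(1) by (simp add: mem_QG_iff)
  then show "(\<lambda>g. c * f g) \<star> h \<in> carrier \<rat>G"
    using assms(2) by (rule conv_mem)
  show "(\<lambda>g. c * (f \<star> h) g) \<in> carrier \<rat>G"
    using conv_mem[OF assms] by (simp add: mem_QG_iff)
  fix g assume "g \<in> carrier G"
  then show "((\<lambda>g. c * f g) \<star> h) g = c * (f \<star> h) g"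
    using assms m by (simp add: conv_apply sum_distrib_left mult.assoc)
qed

lemma conv_scale_right:
  assumes "f \<in> carrier \<rat>G" "h \<in> carrier \<rat>G"
  shows "f \<star> (\<lambda>g. c * h g) = (\<lambda>g. c * (f \<star> h) g)"
proof -
  have "(\<lambda>g. c * h g) \<in> carrier \<rat>G"
    using assms(2) by (simp add: mem_QG_iff)
  then show ?thesis
    using assms by (metis conv_comm conv_scale_left)
qed

lemma scale_mem: "f \<in> carrier \<rat>G \<Longrightarrow> (\<lambda>g. c * f g) \<in> carrier \<rat>G"
  by (simp add: mem_QG_iff)

lemma sum_mem: "(\<And>k. k \<in> K \<Longrightarrow> F k \<in> carrier \<rat>G) \<Longrightarrow> (\<lambda>g. \<Sum>k\<in>K. F k g) \<in> carrier \<rat>G"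
  by (simp add: mem_QG_iff)

lemma sum_conv_left:
  assumes F: "\<And>k. k \<in> K \<Longrightarrow> F k \<in> carrier \<rat>G" and h: "h \<in> carrier \<rat>G"
  shows "((\<lambda>g. \<Sum>k\<in>K. F k g) \<star> h) = (\<lambda>g. \<Sum>k\<in>K. (F k \<star> h) g)"
proof (rule QG_eqI)
  show "(\<lambda>g. \<Sum>k\<in>K. F k g) \<star> h \<in> carrier \<rat>G" "(\<lambda>g. \<Sum>k\<in>K. (F k \<star> h) g) \<in> carrier \<rat>G"
    using F h by (auto intro!: conv_mem sum_mem)
  fix g assume g: "g \<in> carrier G"
  have "((\<lambda>g. \<Sum>k\<in>K. F k g) \<star> h) g = (\<Sum>b\<in>carrier G. \<Sum>k\<in>K. F k (g \<otimes> inv b) * h b)"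
    using sum_mem[of K F] F h g by (simp add: conv_apply sum_distrib_right)
  also have "\<dots> = (\<Sum>k\<in>K. \<Sum>b\<in>carrier G. F k (g \<otimes> inv b) * h b)"
    by (rule sum.swap)
  finally show "((\<lambda>g. \<Sum>k\<in>K. F k g) \<star> h) g = (\<Sum>k\<in>K. (F k \<star> h) g)"
    using F h g by (simp add: conv_apply)
qed

text \<open>The binomial coefficients are kept as rational scalars on coefficient functions, so that
  their divisibility by a prime can be read off at each group element.\<close>

lemma QG_binomial:
  assumes f: "f \<in> carrier \<rat>G" and h: "h \<in> carrier \<rat>G"
  shows "(f \<oplus>\<^bsub>\<rat>G\<^esub> h) [^]\<^bsub>\<rat>G\<^esub> n =
    (\<lambda>g. \<Sum>k\<le>n. of_nat (n choose k) * (f [^]\<^bsub>\<rat>G\<^esub> k \<star> h [^]\<^bsub>\<rat>G\<^esub> (n - k)) g)"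
proof (induction n)
  case 0
  show ?case
    by (simp add: QG.one_closed)
next
  case (Suc n)
  define T where "T k = f [^]\<^bsub>\<rat>G\<^esub> k \<star> h [^]\<^bsub>\<rat>G\<^esub> (Suc n - k)" for k
  let ?F = "\<lambda>k. \<lambda>g. of_nat (n choose k) * (f [^]\<^bsub>\<rat>G\<^esub> k \<star> h [^]\<^bsub>\<rat>G\<^esub> (n - k)) g"
  have mem: "f [^]\<^bsub>\<rat>G\<^esub> k \<star> h [^]\<^bsub>\<rat>G\<^esub> j \<in> carrier \<rat>G" for k j :: nat
    using f h by simp
  have Fmem: "?F k \<in> carrier \<rat>G" for k
    by (intro scale_mem mem)
  have Ff: "?F k \<star> f = (\<lambda>g. of_nat (n choose k) * T (Suc k) g)" for k
  proof -
    have "f [^]\<^bsub>\<rat>G\<^esub> k \<star> h [^]\<^bsub>\<rat>G\<^esub> (n - k) \<star> f = T (Suc k)"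
      using f h by (simp add: T_def QG.m_ac)
    then show ?thesis
      using conv_scale_left[OF mem f] by simp
  qed
  have Fh: "?F k \<star> h = (\<lambda>g. of_nat (n choose k) * T k g)" if "k \<le> n" for k
  proof -
    have "f [^]\<^bsub>\<rat>G\<^esub> k \<star> h [^]\<^bsub>\<rat>G\<^esub> (n - k) \<star> h = T k"
      using f h that by (simp add: T_def QG.m_assoc Suc_diff_le)
    then show ?thesis
      using conv_scale_left[OF mem h] by simp
  qed
  have S: "(\<lambda>g. \<Sum>k\<le>n. ?F k g) \<in> carrier \<rat>G"
    by (intro sum_mem Fmem)
  have "(f \<oplus>\<^bsub>\<rat>G\<^esub> h) [^]\<^bsub>\<rat>G\<^esub> Suc n = (\<lambda>g. \<Sum>k\<le>n. ?F k g) \<star> (f \<oplus>\<^bsub>\<rat>G\<^esub> h)"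
    using Suc.IH by simp
  also have "\<dots> = (\<lambda>g. \<Sum>k\<le>n. ?F k g) \<star> f \<oplus>\<^bsub>\<rat>G\<^esub> (\<lambda>g. \<Sum>k\<le>n. ?F k g) \<star> h"
    using S f h by (simp add: QG.r_distr)
  also have "\<dots> = (\<lambda>g. (\<Sum>k\<le>n. of_nat (n choose k) * T (Suc k) g) + (\<Sum>k\<le>n. of_nat (n choose k) * T k g))"
    unfolding sum_conv_left[OF Fmem f] sum_conv_left[OF Fmem h] Ff
    by (rule ext) (simp add: add_apply Fh)
  also have "\<dots> = (\<lambda>g. \<Sum>k\<le>Suc n. of_nat (Suc n choose k) * T k g)"
  proof
    fix g
    \<comment> \<open>The added term is zero because \<open>n choose Suc n = 0\<close>; after the
      shift of the index the two sums combine by Pascal's rule.\<close>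
    have "(\<Sum>k\<le>n. of_nat (n choose k) * T k g) = (\<Sum>k\<le>Suc n. of_nat (n choose k) * T k g)"
      by simp
    also have "\<dots> = T 0 g + (\<Sum>k\<le>n. of_nat (n choose Suc k) * T (Suc k) g)"
      by (subst sum.atMost_Suc_shift) simp
    finally show "(\<Sum>k\<le>n. of_nat (n choose k) * T (Suc k) g) + (\<Sum>k\<le>n. of_nat (n choose k) * T k g)
        = (\<Sum>k\<le>Suc n. of_nat (Suc n choose k) * T k g)"
      by (subst sum.atMost_Suc_shift) (simp add: ring_distribs sum.distrib)
  qed
  finally show ?case
    by (simp only: T_def)
qed

lemma conv_Ints:
  assumes "f \<in> carrier \<rat>G" "h \<in> carrier \<rat>G" "\<And>g. f g \<in> \<int>" "\<And>g. h g \<in> \<int>"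
  shows "(f \<star> h) g \<in> \<int>"
  using assms by (cases "g \<in> carrier G") (auto simp: conv_apply conv_outside)

lemma pow_Ints:
  assumes "f \<in> carrier \<rat>G" "\<And>g. f g \<in> \<int>"
  shows "(f [^]\<^bsub>\<rat>G\<^esub> (n::nat)) g \<in> \<int>"
proof (induction n arbitrary: g)
  case 0
  show ?case
    by (simp add: one_eq group_basis_def)
next
  case (Suc n)
  then show ?case
    using assms by (simp add: conv_Ints)
qed

text \<open>The inner binomial coefficients are divisible by \<open>q\<close>, and integrality of
  \<open>f\<close> and \<open>h\<close> makes the cofactors integers, so raising to the power
  \<open>q\<close> is additive modulo \<open>q\<close>.\<close>

lemma QG_freshman:
  assumes q: "prime (q::nat)"
    and f: "f \<in> carrier \<rat>G" "\<And>g. f g \<in> \<int>" and h: "h \<in> carrier \<rat>G" "\<And>g. h g \<in> \<int>"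
  shows "\<exists>c::int. ((f \<oplus>\<^bsub>\<rat>G\<^esub> h) [^]\<^bsub>\<rat>G\<^esub> q) g =
    (f [^]\<^bsub>\<rat>G\<^esub> q) g + (h [^]\<^bsub>\<rat>G\<^esub> q) g + of_int (int q * c)"
proof -
  define T where "T k = (f [^]\<^bsub>\<rat>G\<^esub> k \<star> h [^]\<^bsub>\<rat>G\<^esub> (q - k)) g" for k
  have "\<exists>c::int. of_nat (q choose k) * T k = of_int (int q * c)" if "k \<in> {0<..<q}" for k
  proof -
    have "q dvd q choose k"
      using that by (intro dvd_choose_prime) (use q in auto)
    then obtain d where d: "q choose k = q * d" ..
    have "T k \<in> \<int>"
      unfolding T_def by (intro conv_Ints pow_Ints) (use f h in auto)
    then obtain t where "T k = of_int t"
      by (auto elim: Ints_cases)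
    with d show ?thesis
      by (intro exI[of _ "int d * t"]) simp
  qed
  then obtain c where c: "\<And>k. k \<in> {0<..<q} \<Longrightarrow> of_nat (q choose k) * T k = of_int (int q * c k)"
    by metis
  have q0: "q > 0"
    using q by (simp add: prime_gt_0_nat)
  then have *: "{..q} = insert 0 (insert q {0<..<q})"
    by auto
  have "((f \<oplus>\<^bsub>\<rat>G\<^esub> h) [^]\<^bsub>\<rat>G\<^esub> q) g = (\<Sum>k\<le>q. of_nat (q choose k) * T k)"
    using f h by (simp add: QG_binomial T_def)
  also have "\<dots> = T 0 + T q + (\<Sum>k\<in>{0<..<q}. of_nat (q choose k) * T k)"
    unfolding * using q0 by simp
  also have "T 0 = (h [^]\<^bsub>\<rat>G\<^esub> q) g"
    using f h by (simp add: T_def)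
  also have "T q = (f [^]\<^bsub>\<rat>G\<^esub> q) g"
    using f h by (simp add: T_def)
  also have "(\<Sum>k\<in>{0<..<q}. of_nat (q choose k) * T k) = of_int (int q * (\<Sum>k\<in>{0<..<q}. c k))"
    by (simp add: c sum_distrib_left)
  finally show ?thesis
    by (intro exI[of _ "\<Sum>k\<in>{0<..<q}. c k"]) simp
qed

lemma basis_pow:
  assumes s: "s \<in> carrier G"
  shows "(\<lambda>g. b * group_basis s g) [^]\<^bsub>\<rat>G\<^esub> (n::nat) = (\<lambda>g. b ^ n * group_basis (s [^] n) g)"
proof (induction n)
  case 0
  show ?case
    by (simp add: one_eq)
next
  case (Suc n)
  have "group_basis (s [^] n) \<star> group_basis s = group_basis (s [^] Suc n)"
  proof (rule QG_eqI)
    fix g assume g: "g \<in> carrier G"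
    have "g \<otimes> inv (s [^] n) = s \<longleftrightarrow> g = s [^] Suc n"
      using g s by (metis inv_solve_right' nat_pow_Suc nat_pow_closed m_comm)
    moreover have "(group_basis (s [^] n) \<star> group_basis s) g = group_basis s (g \<otimes> inv (s [^] n))"
      using g s by (simp add: basis_conv basis_mem)
    ultimately show "(group_basis (s [^] n) \<star> group_basis s) g = group_basis (s [^] Suc n) g"
      by (simp add: group_basis_def)
  qed (use s in \<open>auto intro!: conv_mem basis_mem\<close>)
  then show ?case
    using s Suc.IH
    by (simp add: conv_scale_left conv_scale_right scale_mem basis_mem mult_ac)
qed

text \<open>An integral element is a sum of monomials; adding them one at a time, the
  \<open>q\<close>-th power is taken monomial by monomial modulo \<open>q\<close>.\<close>

lemma QG_frobenius:
  assumes q: "prime (q::nat)" and "finite S" "S \<subseteq> carrier G"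
  shows "\<exists>c::int. ((\<lambda>g. if g \<in> S then of_int (b g) else 0) [^]\<^bsub>\<rat>G\<^esub> q) g =
    (\<Sum>s\<in>S. of_int (b s) ^ q * group_basis (s [^] q) g) + of_int (int q * c)"
  using assms(2,3)
proof (induction S)
  case empty
  have "\<zero>\<^bsub>\<rat>G\<^esub> [^]\<^bsub>\<rat>G\<^esub> q = \<zero>\<^bsub>\<rat>G\<^esub>"
    using q by (simp add: QG.nat_pow_zero prime_gt_0_nat)
  then have "(\<lambda>g. 0) [^]\<^bsub>\<rat>G\<^esub> q = (\<lambda>g. 0)"
    by (simp add: rat_group_algebra_def)
  then show ?case
    by (auto intro: exI[of _ 0])
next
  case (insert s S)
  let ?f = "\<lambda>g. if g \<in> S then of_int (b g) else 0" and ?h = "\<lambda>g. of_int (b s) * group_basis s g"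
  have "(\<lambda>g. if g \<in> insert s S then of_int (b g) else 0) = ?f \<oplus>\<^bsub>\<rat>G\<^esub> ?h"
    using insert.hyps by (auto simp: add_apply group_basis_def)
  moreover have "?f \<in> carrier \<rat>G"
    using insert.prems by (auto simp: mem_QG_iff)
  moreover have "?h \<in> carrier \<rat>G"
    using insert.prems by (intro scale_mem basis_mem) auto
  moreover have "?f g \<in> \<int>" "?h g \<in> \<int>" for g
    by (auto simp: group_basis_def)
  ultimately obtain c where c: "((\<lambda>g. if g \<in> insert s S then of_int (b g) else 0) [^]\<^bsub>\<rat>G\<^esub> q) g =
      (?f [^]\<^bsub>\<rat>G\<^esub> q) g + (?h [^]\<^bsub>\<rat>G\<^esub> q) g + of_int (int q * c)"
    using QG_freshman[OF q, of ?f ?h g] by metis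
  moreover obtain d where
    "(?f [^]\<^bsub>\<rat>G\<^esub> q) g = (\<Sum>s\<in>S. of_int (b s) ^ q * group_basis (s [^] q) g) + of_int (int q * d)"
    using insert by auto
  ultimately show ?case
    using insert.hyps insert.prems by (intro exI[of _ "c + d"]) (simp add: basis_pow ring_distribs)
qed

text \<open>The element \<open>D e\<close> is integral and its \<open>q\<close>-th power is
  \<open>D ^ q\<close> times \<open>e\<close>. By Frobenius its coefficient at
  \<open>g [^] q\<close> is congruent to \<open>b g ^ q\<close>, since injectivity leaves
  \<open>g\<close> as the only \<open>q\<close>-th root. Fermat's theorem then removes the
  exponents.\<close>

lemma idempotent_pow_prime_dvd:
  assumes q: "prime (q::nat)"
    and e: "e \<in> carrier \<rat>G" "e \<star> e = e"
    and D: "0 < D" "\<And>g. g \<in> carrier G \<Longrightarrow> of_nat D * e g \<in> \<int>"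
    and inj: "inj_on (\<lambda>g. g [^] q) (carrier G)"
    and g: "g \<in> carrier G"
  shows "\<exists>c::int. of_nat (D * D) * (e (g [^] q) - e g) = of_int (int q * c)"
proof -
  define b where "b g = (if g \<in> carrier G then \<lfloor>of_nat D * e g\<rfloor> else 0)" for g
  have b: "of_int (b g) = of_nat D * e g" for g
    using D(2)[of g] e(1) by (auto simp: b_def QG_outside elim: Ints_cases)
  have epow: "e [^]\<^bsub>\<rat>G\<^esub> Suc n = e" for n
    by (induction n) (use e in auto)
  have Dpow: "(\<lambda>g. of_nat D * e g) [^]\<^bsub>\<rat>G\<^esub> n = (\<lambda>g. of_nat D ^ n * (e [^]\<^bsub>\<rat>G\<^esub> n) g)" for n :: nat
  proof (induction n)
    case (Suc n)
    then show ?case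
      using e(1) by (simp add: conv_scale_left conv_scale_right scale_mem mult_ac)
  qed simp
  have q0: "q > 0"
    using q by (simp add: prime_gt_0_nat)
  then obtain q' where "q = Suc q'"
    using gr0_implies_Suc by blast
  then have pw: "e [^]\<^bsub>\<rat>G\<^esub> q = e"
    using epow by simp
  have "(\<lambda>g. if g \<in> carrier G then of_int (b g) else 0) = (\<lambda>g. of_nat D * e g)"
    using e(1) by (auto simp: b QG_outside)
  then obtain c where c: "((\<lambda>g. of_nat D * e g) [^]\<^bsub>\<rat>G\<^esub> q) (g [^] q) =
      (\<Sum>s\<in>carrier G. of_int (b s) ^ q * group_basis (s [^] q) (g [^] q)) + of_int (int q * c)"
    using QG_frobenius[OF q finite_carrier, of b "g [^] q"] by auto
  have "(\<Sum>s\<in>carrier G. of_int (b s) ^ q * group_basis (s [^] q) (g [^] q))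
      = (\<Sum>s\<in>carrier G. if s = g then of_int (b s) ^ q else (0::rat))"
  proof (rule sum.cong[OF refl])
    fix s assume "s \<in> carrier G"
    then have "g [^] q = s [^] q \<longleftrightarrow> s = g"
      using inj g by (auto dest: inj_onD)
    then show "of_int (b s) ^ q * group_basis (s [^] q) (g [^] q) = (if s = g then of_int (b s) ^ q else (0::rat))"
      by (simp add: group_basis_def)
  qed
  also have "\<dots> = of_int (b g ^ q)"
    using finite_carrier g by simp
  finally have 1: "of_nat D ^ q * e (g [^] q) = of_int (b g ^ q) + of_int (int q * c)"
    using c by (simp add: Dpow pw)
  obtain u where u: "b g ^ q = b g + int q * u"
    using prime_dvd_pow_diff_self[OF q, of "b g"] by (auto simp: dvd_def algebra_simps)
  obtain v where v: "int D ^ q = int D + int q * v"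
    using prime_dvd_pow_diff_self[OF q, of "int D"] by (auto simp: dvd_def algebra_simps)
  have v': "(of_nat D::rat) ^ q = of_nat D + of_nat q * of_int v"
    using arg_cong[OF v, of "of_int :: int \<Rightarrow> rat"] by simp
  \<comment> \<open>The extra factor \<open>D\<close> turns \<open>e (g [^] q)\<close> into an
    integer, so \<open>D ^ q\<close> can be replaced by \<open>D\<close> modulo \<open>q\<close>
    without inverting \<open>D\<close>; this accounts for the square of \<open>D\<close> in the
    conclusion.\<close>
  have "of_nat D * (of_nat D ^ q * e (g [^] q)) = of_nat D ^ q * of_int (b (g [^] q))"
    by (simp add: b)
  also have "\<dots> = of_nat D * of_int (b (g [^] q)) + of_int (int q * (v * b (g [^] q)))"
    unfolding v' by (simp add: algebra_simps)
  finally have "of_nat D * of_int (b (g [^] q)) - of_nat D * of_int (b g)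
      = (of_int (int q * (int D * u + int D * c - v * b (g [^] q))) :: rat)"
    unfolding 1 u by (simp add: algebra_simps)
  then have "of_nat (D * D) * (e (g [^] q) - e g) = of_int (int q * (int D * u + int D * c - v * b (g [^] q)))"
    by (simp add: b algebra_simps)
  then show ?thesis ..
qed

end

section \<open>Coefficients of idempotents under coprime powers\<close>

text \<open>Take for \<open>t\<close> the product of the small primes other than \<open>p\<close>
  that do not divide \<open>k\<close>. Each small prime other than \<open>p\<close> then divides
  exactly one of \<open>k\<close> and the shift, hence not their sum. The exponent
  \<open>Suc n\<close> makes \<open>p\<close> divide the shift even for \<open>n = 0\<close>, so
  \<open>p\<close> does not divide the sum either.\<close>

lemma exists_shift_large_prime_divisors:
  fixes p k n M :: nat
  assumes p: "prime p" and k: "\<not> p dvd k"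
  shows "\<exists>t. \<forall>r. prime r \<longrightarrow> r dvd k + p ^ Suc n * t \<longrightarrow> M < r \<and> r \<noteq> p"
proof -
  define S where "S = {r. prime r \<and> r \<le> M \<and> \<not> r dvd k \<and> r \<noteq> p}"
  have fin: "finite S"
    by (rule finite_subset[of _ "{..M}"]) (auto simp: S_def)
  have "M < r \<and> r \<noteq> p" if r: "prime r" "r dvd k + p ^ Suc n * \<Prod>S" for r
  proof (rule ccontr)
    assume neg: "\<not> (M < r \<and> r \<noteq> p)"
    show False
    proof (cases "r dvd k \<or> r = p")
      case True
      then have "r \<noteq> p" "r dvd k"
        using k r(2) by (auto simp: dvd_add_left_iff)
      then have "r dvd p ^ Suc n * \<Prod>S"
        using r(2) by (simp add: dvd_add_right_iff)
      then consider "r dvd p ^ Suc n" | "r dvd \<Prod>S"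
        using r(1) by (auto simp: prime_dvd_mult_iff)
      then show False
      proof cases
        case 1
        then have "r = p"
          using r(1) p primes_dvd_imp_eq prime_dvd_power by blast
        with \<open>r \<noteq> p\<close> show False ..
      next
        case 2
        then obtain u where "u \<in> S" "r dvd u"
          using prime_dvd_prod_iff[OF fin r(1), of "\<lambda>x. x"] by auto
        then have "r = u"
          using r(1) primes_dvd_imp_eq by (auto simp: S_def)
        with \<open>u \<in> S\<close> \<open>r dvd k\<close> show False
          by (simp add: S_def)
      qed
    next
      case False
      with neg r(1) have "r \<in> S"
        by (auto simp: S_def)
      then have "r dvd p ^ Suc n * \<Prod>S"
        using fin by (intro dvd_mult) (rule dvd_prodI)
      with False r(2) show False
        by (simp add: dvd_add_left_iff)
    qed
  qed
  then show ?thesis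
    by blast
qed

context finite_comm_group
begin

section \<open>Powers in a group of finite exponent\<close>

lemma pow_mod_exponent:
  assumes g: "g \<in> carrier G" and N: "g [^] (N::nat) = \<one>"
  shows "g [^] k = g [^] (k mod N)"
proof -
  have "g [^] k = g [^] (N * (k div N) + k mod N)"
    by simp
  also have "\<dots> = (g [^] N) [^] (k div N) \<otimes> g [^] (k mod N)"
    using g by (simp only: nat_pow_mult[symmetric] nat_pow_pow)
  finally show ?thesis
    using g N by simp
qed

text \<open>An inverse \<open>q'\<close> of \<open>q\<close> modulo \<open>N\<close> provides the
  inverse map.\<close>

lemma inj_on_pow_coprime:
  assumes N: "\<And>g. g \<in> carrier G \<Longrightarrow> g [^] (N::nat) = \<one>" and q: "coprime q N"
  shows "inj_on (\<lambda>g. g [^] q) (carrier G)"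
proof (rule inj_onI)
  obtain q' where q': "[q * q' = 1] (mod N)"
    using cong_solve_coprime_nat[OF q] by auto
  have *: "(g [^] q) [^] q' = g" if "g \<in> carrier G" for g
  proof -
    have "(g [^] q) [^] q' = g [^] (q * q' mod N)"
      using that pow_mod_exponent[OF that N[OF that], of "q * q'"] by (simp add: nat_pow_pow)
    also have "q * q' mod N = 1 mod N"
      using q' by (simp add: cong_def)
    also have "g [^] (1 mod N) = g"
      using that pow_mod_exponent[OF that N[OF that], of 1] by simp
    finally show ?thesis .
  qed
  fix g h assume "g \<in> carrier G" "h \<in> carrier G" "g [^] q = h [^] q"
  then show "g = h"
    using * by metis
qed

text \<open>The number \<open>D * D * (e (g [^] q) - e g)\<close> is a multiple of \<open>q\<close>,
  while its size is bounded independently of \<open>q\<close>; for large \<open>q\<close> it must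
  vanish.\<close>

lemma idempotent_pow_large_prime:
  assumes e: "e \<in> carrier \<rat>G" "e \<star> e = e"
    and N: "\<And>g. g \<in> carrier G \<Longrightarrow> g [^] (N::nat) = \<one>"
  shows "\<exists>M. \<forall>q. prime q \<longrightarrow> M < q \<longrightarrow> coprime q N \<longrightarrow> (\<forall>g\<in>carrier G. e (g [^] q) = e g)"
proof -
  obtain D :: nat where D: "0 < D" "\<And>g. g \<in> carrier G \<Longrightarrow> of_nat D * e g \<in> \<int>"
    using finite_common_denominator[OF finite_carrier, of e] by auto
  \<comment> \<open>As a sum of nonnegative terms, \<open>B\<close> bounds all the scaled
    coefficients at once.\<close>
  define B where "B = (\<Sum>g\<in>carrier G. of_nat (D * D) * \<bar>e g\<bar>)"
  obtain M :: nat where M: "2 * B \<le> of_nat M"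
    using real_arch_simple by blast
  have "e (g [^] q) = e g" if q: "prime q" "M < q" "coprime q N" and g: "g \<in> carrier G" for q g
  proof (rule ccontr)
    assume ne: "e (g [^] q) \<noteq> e g"
    obtain c :: int where c: "of_nat (D * D) * (e (g [^] q) - e g) = of_int (int q * c)"
      using idempotent_pow_prime_dvd[OF q(1) e D inj_on_pow_coprime[OF N q(3)] g] by auto
    have bnd: "of_nat (D * D) * \<bar>e h\<bar> \<le> B" if "h \<in> carrier G" for h
      unfolding B_def by (rule member_le_sum[OF that]) (use finite_carrier in auto)
    have "c \<noteq> 0"
      using c ne D(1) by auto
    then have "(of_int 1 :: rat) \<le> of_int \<bar>c\<bar>"
      by (subst of_int_le_iff) simp
    then have "of_nat q * 1 \<le> of_nat q * \<bar>of_int c :: rat\<bar>"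
      by (intro mult_left_mono) simp_all
    also have "\<dots> = \<bar>of_nat (D * D) * (e (g [^] q) - e g)\<bar>"
      unfolding c by (simp add: abs_mult)
    also have "\<dots> = of_nat (D * D) * \<bar>e (g [^] q) - e g\<bar>"
      by (simp add: abs_mult)
    also have "\<dots> \<le> of_nat (D * D) * (\<bar>e (g [^] q)\<bar> + \<bar>e g\<bar>)"
      by (intro mult_left_mono) auto
    also have "\<dots> \<le> 2 * B"
      using bnd[OF g] bnd[of "g [^] q"] g by (simp add: ring_distribs)
    also have "\<dots> \<le> of_nat M"
      by (rule M)
    finally show False
      using q(2) by simp
  qed
  then show ?thesis
    by blast
qed

text \<open>Modulo the exponent \<open>p ^ n\<close>, the number \<open>k\<close> can be replaced by
  a product of large primes different from \<open>p\<close>, and each prime factor leaves the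
  coefficients unchanged.\<close>

lemma idempotent_pow_coprime:
  assumes e: "e \<in> carrier \<rat>G" "e \<star> e = e"
    and p: "prime p" and pn: "\<And>g. g \<in> carrier G \<Longrightarrow> g [^] (p ^ n :: nat) = \<one>"
    and k: "\<not> p dvd k" and g: "g \<in> carrier G"
  shows "e (g [^] k) = e g"
proof -
  obtain M where M: "\<And>q g. \<lbrakk>prime q; M < q; coprime q (p ^ n); g \<in> carrier G\<rbrakk> \<Longrightarrow> e (g [^] q) = e g"
    using idempotent_pow_large_prime[OF e pn] by blast
  obtain t where t: "\<And>r. \<lbrakk>prime r; r dvd k + p ^ Suc n * t\<rbrakk> \<Longrightarrow> M < r \<and> r \<noteq> p"
    using exists_shift_large_prime_divisors[OF p k, of n M] by blast
  define k' where "k' = k + p ^ Suc n * t"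
  have *: "e (g [^] x) = e g"
    if "x \<noteq> 0" "\<And>r. \<lbrakk>prime r; r dvd x\<rbrakk> \<Longrightarrow> M < r \<and> r \<noteq> p" "g \<in> carrier G" for x g
    using that
  proof (induction x arbitrary: g rule: prime_divisors_induct)
    case (factor q x)
    have q: "M < q" "coprime q (p ^ n)"
      using factor.prems(2)[of q] factor.hyps p by (auto simp: primes_coprime)
    have "e (g [^] (q * x)) = e ((g [^] q) [^] x)"
      using factor.prems by (simp add: nat_pow_pow)
    also have "\<dots> = e (g [^] q)"
      by (rule factor.IH) (use factor.prems in auto)
    also have "\<dots> = e g"
      using M[OF factor.hyps q] factor.prems by simp
    finally show ?case .
  qed auto
  have "k \<noteq> 0"
    using k by (metis dvd_0_right)
  then have "e (g [^] k') = e g"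
    using t g by (intro *) (auto simp: k'_def)
  \<comment> \<open>The shift equals \<open>p ^ n * (p * t)\<close>.\<close>
  moreover have "k' mod p ^ n = k mod p ^ n"
    using mod_mult_self2[of k "p ^ n" "p * t"] by (simp add: k'_def ac_simps)
  ultimately show ?thesis
    using pow_mod_exponent[OF g pn[OF g], of k] pow_mod_exponent[OF g pn[OF g], of k'] by simp
qed

end

section \<open>Stabilizers and products of the elements \<open>e\<^sub>x\<close>\<close>

context finite_comm_group
begin

text \<open>For \<open>f\<close> in the group algebra these are the \<open>y\<close> with
  \<open>y f = f\<close>, stated through coefficients so that the set is a subgroup for any function
  \<open>f\<close>.\<close>

definition stab :: "('a \<Rightarrow> rat) \<Rightarrow> 'a set" where
  "stab f = {y \<in> carrier G. \<forall>g\<in>carrier G. f (g \<otimes> y) = f g}"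

lemma stabD: "y \<in> stab f \<Longrightarrow> g \<in> carrier G \<Longrightarrow> f (g \<otimes> y) = f g"
  by (simp add: stab_def)

lemma subgroup_stab: "subgroup (stab f) G"
proof (rule subgroupI)
  fix y assume y: "y \<in> stab f"
  then have yc: "y \<in> carrier G"
    by (simp add: stab_def)
  have "f (g \<otimes> inv y) = f g" if "g \<in> carrier G" for g
    using stabD[OF y, of "g \<otimes> inv y"] that yc by (simp add: m_assoc)
  with yc show "inv y \<in> stab f"
    by (simp add: stab_def)
next
  fix y z assume "y \<in> stab f" "z \<in> stab f"
  then show "y \<otimes> z \<in> stab f"
    by (simp add: stab_def m_assoc[symmetric])
qed (auto simp: stab_def)

lemma stab_carrier: "y \<in> stab f \<Longrightarrow> y \<in> carrier G"
  by (simp add: stab_def)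

lemma subgroup_pow: "subgroup K G \<Longrightarrow> y \<in> K \<Longrightarrow> y [^] (n::nat) \<in> K"
  by (induction n) (auto simp: subgroup.one_closed subgroup.m_closed)

lemma subgroup_mult_left_iff:
  assumes "subgroup K G" "y \<in> K" "g \<in> carrier G"
  shows "g \<otimes> y \<in> K \<longleftrightarrow> g \<in> K"
proof
  assume "g \<otimes> y \<in> K"
  then have "g \<otimes> y \<otimes> inv y \<in> K"
    using assms by (simp add: subgroup.m_closed subgroup.m_inv_closed)
  then show "g \<in> K"
    using assms subgroup.mem_carrier[OF assms(1,2)] by (simp add: m_assoc)
qed (use assms in \<open>simp add: subgroup.m_closed\<close>)

text \<open>With \<open>d\<close> an inverse of \<open>j\<close> modulo \<open>p\<close>,
  \<open>y\<close> equals \<open>(y [^] j) [^] d\<close> up to a power of \<open>y [^] p\<close>, so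
  \<open>y [^] j \<in> K\<close> would give \<open>y \<in> K\<close>.\<close>

lemma prime_pow_notin_subgroup:
  assumes K: "subgroup K G" and p: "prime (p::nat)"
    and y: "y \<in> carrier G" "y \<notin> K" "y [^] p \<in> K" and j: "0 < j" "j < p"
  shows "y [^] j \<notin> K"
proof
  assume yj: "y [^] j \<in> K"
  have "coprime j p"
    using p j by (metis coprime_commute nat_dvd_not_less prime_imp_coprime)
  then obtain d where "[j * d = 1] (mod p)"
    using cong_solve_coprime_nat by auto
  then have m: "j * d mod p = 1"
    using prime_gt_Suc_0_nat[OF p] by (simp add: cong_def)
  have "j * d = 1 + p * (j * d div p)"
    using m by (metis add.commute mult_div_mod_eq)
  then have "(y [^] j) [^] d = y \<otimes> (y [^] p) [^] (j * d div p)"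
    using y(1) by (metis nat_pow_eone nat_pow_mult nat_pow_pow)
  moreover have "(y [^] j) [^] d \<in> K" "(y [^] p) [^] (j * d div p) \<in> K"
    using K yj y by (auto intro: subgroup_pow)
  ultimately show False
    using subgroup_mult_left_iff[OF K] y by metis
qed

lemma stab_conv_left:
  assumes f: "f \<in> carrier \<rat>G" and h: "h \<in> carrier \<rat>G" and y: "y \<in> stab f"
  shows "y \<in> stab (f \<star> h)"
proof -
  have yc: "y \<in> carrier G"
    using y by (rule stab_carrier)
  have "(f \<star> h) (g \<otimes> y) = (f \<star> h) g" if g: "g \<in> carrier G" for g
  proof -
    have "f (g \<otimes> y \<otimes> inv b) = f (g \<otimes> inv b)" if b: "b \<in> carrier G" for b
    proof -
      have "g \<otimes> y \<otimes> inv b = g \<otimes> inv b \<otimes> y"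
        using g b yc by (simp add: m_ac)
      then show ?thesis
        using stabD[OF y, of "g \<otimes> inv b"] g b by simp
    qed
    then show ?thesis
      using f h g yc by (simp add: conv_apply)
  qed
  then show ?thesis
    using yc by (simp add: stab_def)
qed

lemma stab_conv_right:
  "f \<in> carrier \<rat>G \<Longrightarrow> h \<in> carrier \<rat>G \<Longrightarrow> y \<in> stab h \<Longrightarrow> y \<in> stab (f \<star> h)"
  using stab_conv_left[of h f y] by (simp add: conv_comm)

section \<open>Multiplication by \<open>e_elem\<close> as an average of translates\<close>

lemma e_elem_mem: "x \<in> carrier G \<Longrightarrow> e_elem G p x \<in> carrier \<rat>G"
  by (auto simp: mem_QG_iff e_elem_def group_basis_def intro!: sum.neutral)

lemma e_elem_conv:
  assumes x: "x \<in> carrier G" and f: "f \<in> carrier \<rat>G" and g: "g \<in> carrier G"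
  shows "(e_elem G p x \<star> f) g = (\<Sum>k<p. f (g \<otimes> inv (x [^] k))) / of_nat p"
proof -
  have "e_elem G p x = (\<lambda>g. inverse (of_nat p) * (\<Sum>k<p. group_basis (x [^] k) g))"
    by (simp add: e_elem_def divide_inverse mult.commute)
  then show ?thesis
    using x f g by (simp add: conv_scale_left sum_conv_left basis_mem sum_mem basis_conv divide_inverse mult.commute)
qed

lemma e_elem_conv_stab:
  assumes x: "x \<in> stab f" and f: "f \<in> carrier \<rat>G" and p: "p > 0"
  shows "e_elem G p x \<star> f = f"
proof (rule QG_eqI)
  have xc: "x \<in> carrier G"
    using x by (rule stab_carrier)
  show "e_elem G p x \<star> f \<in> carrier \<rat>G"
    using xc f by (intro conv_mem e_elem_mem)
  fix g assume g: "g \<in> carrier G"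
  have "f (g \<otimes> inv (x [^] k)) = f g" for k :: nat
    using subgroup_stab x g by (intro stabD) (auto intro: subgroup_pow subgroup.m_inv_closed)
  then show "(e_elem G p x \<star> f) g = f g"
    using xc f g p by (simp add: e_elem_conv)
qed (rule f)

text \<open>Translation by \<open>x\<close> shifts the \<open>p\<close> summands cyclically; the
  wrap-around is harmless because \<open>x [^] p\<close> fixes \<open>f\<close>. The order of
  \<open>x\<close> itself may exceed \<open>p\<close>.\<close>

lemma stab_e_elem_conv:
  assumes x: "x \<in> carrier G" and f: "f \<in> carrier \<rat>G" and xp: "x [^] p \<in> stab f"
  shows "x \<in> stab (e_elem G p x \<star> f)"
proof -
  have "(e_elem G p x \<star> f) (g \<otimes> inv x) = (e_elem G p x \<star> f) g" if g: "g \<in> carrier G" for g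
  proof -
    define F where "F k = f (g \<otimes> inv (x [^] k))" for k :: nat
    \<comment> \<open>This closes the cycle: the term leaving at one end equals the term entering at
      the other.\<close>
    have "F p = F 0"
      unfolding F_def using stabD[OF subgroup.m_inv_closed[OF subgroup_stab xp] g] g by simp
    moreover have "(\<Sum>k<p. F k) + F p = F 0 + (\<Sum>k<p. F (Suc k))"
      by (metis sum.lessThan_Suc sum.lessThan_Suc_shift)
    moreover have "f (g \<otimes> inv x \<otimes> inv (x [^] k)) = F (Suc k)" for k
      using g x by (simp add: F_def inv_mult_group m_assoc)
    ultimately show ?thesis
      using x f g by (simp add: e_elem_conv F_def)
  qed
  then have "inv x \<in> stab (e_elem G p x \<star> f)"
    using x by (simp add: stab_def)
  then show ?thesis
    using subgroup.m_inv_closed[OF subgroup_stab] x by fastforce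
qed

section \<open>Products of the elements \<open>e_elem\<close> attached to a subgroup\<close>

abbreviation e_prod :: "nat \<Rightarrow> 'a list \<Rightarrow> 'a \<Rightarrow> rat" where
  "e_prod p xs \<equiv> list_product \<rat>G (map (e_elem G p) xs)"

lemma list_product_simps:
  "list_product \<rat>G [] = \<one>\<^bsub>\<rat>G\<^esub>" "list_product \<rat>G (u # us) = u \<star> list_product \<rat>G us"
  by (simp_all add: list_product_def)

lemma e_prod_mem: "set xs \<subseteq> carrier G \<Longrightarrow> e_prod p xs \<in> carrier \<rat>G"
  by (induction xs) (auto simp: list_product_simps intro!: conv_mem e_elem_mem)

lemma e_prod_append:
  assumes "set xs \<subseteq> carrier G" "set ys \<subseteq> carrier G"
  shows "e_prod p (xs @ ys) = e_prod p xs \<star> e_prod p ys"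
  using assms(1)
  by (induction xs) (auto simp: list_product_simps e_prod_mem assms(2) e_elem_mem conv_assoc)

lemma e_prod_conv_stab:
  assumes "set xs \<subseteq> stab f" "f \<in> carrier \<rat>G" "p > 0"
  shows "e_prod p xs \<star> f = f"
  using assms(1)
proof (induction xs)
  case (Cons x xs)
  then have "x \<in> carrier G" "set xs \<subseteq> carrier G"
    by (auto intro: stab_carrier)
  with Cons assms(2,3) show ?case
    by (simp add: list_product_simps conv_assoc e_elem_mem e_prod_mem e_elem_conv_stab)
qed (use assms(2) in \<open>simp add: list_product_simps\<close>)

lemma e_prod_outside:
  assumes K: "subgroup K G" and "set xs \<subseteq> K" "g \<in> carrier G" "g \<notin> K"
  shows "e_prod p xs g = 0"
  using assms(2-)
proof (induction xs arbitrary: g)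
  case Nil
  then show ?case
    using subgroup.one_closed[OF K] by (auto simp: list_product_simps one_eq group_basis_def)
next
  case (Cons x xs)
  have KC: "K \<subseteq> carrier G"
    using K by (rule subgroup.subset)
  then have x: "x \<in> carrier G" "set xs \<subseteq> carrier G"
    using Cons.prems by auto
  have "g \<otimes> inv (x [^] k) \<notin> K" for k :: nat
    using Cons.prems K subgroup_mult_left_iff[OF K, of "inv (x [^] k)" g]
    by (auto intro: subgroup.m_inv_closed subgroup_pow)
  then have "e_prod p xs (g \<otimes> inv (x [^] k)) = 0" for k :: nat
    using Cons.IH Cons.prems x by simp
  then show ?case
    using Cons.prems x by (simp add: list_product_simps e_elem_conv e_prod_mem)
qed

text \<open>Use the factors of \<open>x\<close>, \<open>x [^] p\<close>,
  \<open>x [^] (p ^ 2)\<close> and so on. The tail of the product is already fixed by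
  \<open>x [^] p\<close>, so putting the factor of \<open>x\<close> in front makes it fixed by
  \<open>x\<close>.\<close>

lemma exists_e_prod_stab_element:
  assumes K: "subgroup K G" and "x \<in> K" "x [^] (p ^ n :: nat) = \<one>"
  shows "\<exists>xs. set xs \<subseteq> K \<and> x \<in> stab (e_prod p xs)"
  using assms(2,3)
proof (induction n arbitrary: x)
  case 0
  then have "x = \<one>"
    using subgroup.mem_carrier[OF K] by simp
  then show ?case
    using subgroup.one_closed[OF subgroup_stab] by (intro exI[of _ "[]"]) simp
next
  case (Suc n)
  have x: "x \<in> carrier G"
    using Suc.prems(1) subgroup.mem_carrier[OF K] by simp
  have "(x [^] p) [^] (p ^ n) = \<one>"
    using Suc.prems(2) x by (simp add: nat_pow_pow)
  then obtain xs where xs: "set xs \<subseteq> K" "x [^] p \<in> stab (e_prod p xs)"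
    using Suc.IH[of "x [^] p"] Suc.prems(1) subgroup_pow[OF K] by blast
  have "set xs \<subseteq> carrier G"
    using xs(1) subgroup.subset[OF K] by auto
  then have "x \<in> stab (e_prod p (x # xs))"
    using stab_e_elem_conv[OF x _ xs(2)] by (simp add: list_product_simps e_prod_mem)
  then show ?case
    using xs(1) Suc.prems(1) by (intro exI[of _ "x # xs"]) simp
qed

text \<open>Concatenate the lists of the single elements of \<open>K\<close>: a product is fixed by
  whatever fixes one of its factors. The result is constant on \<open>K\<close> and, by
  \<open>e_prod_outside\<close>, zero elsewhere, hence a multiple of the trivial idempotent of
  \<open>K\<close>.\<close>

lemma exists_e_prod_stab:
  assumes K: "subgroup K G" and pn: "\<And>x. x \<in> K \<Longrightarrow> x [^] (p ^ n :: nat) = \<one>"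
  shows "\<exists>xs. set xs \<subseteq> K \<and> K \<subseteq> stab (e_prod p xs)"
proof -
  have KC: "K \<subseteq> carrier G"
    using K by (rule subgroup.subset)
  have "\<exists>xs. set xs \<subseteq> K \<and> S \<subseteq> stab (e_prod p xs)" if "finite S" "S \<subseteq> K" for S
    using that
  proof (induction S)
    case (insert x S)
    then obtain xs where xs: "set xs \<subseteq> K" "S \<subseteq> stab (e_prod p xs)"
      by auto
    obtain ys where ys: "set ys \<subseteq> K" "x \<in> stab (e_prod p ys)"
      using exists_e_prod_stab_element[OF K _ pn, of x] insert.prems by auto
    have "e_prod p (ys @ xs) = e_prod p ys \<star> e_prod p xs"
      using xs(1) ys(1) KC by (intro e_prod_append) auto
    moreover have "e_prod p xs \<in> carrier \<rat>G" "e_prod p ys \<in> carrier \<rat>G"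
      using xs(1) ys(1) KC by (auto intro!: e_prod_mem)
    ultimately have "insert x S \<subseteq> stab (e_prod p (ys @ xs))"
      using xs(2) ys(2) stab_conv_left stab_conv_right by auto
    then show ?case
      using xs(1) ys(1) by (intro exI[of _ "ys @ xs"]) auto
  qed (auto intro: exI[of _ "[]"])
  moreover have "finite K"
    using KC finite_carrier by (rule finite_subset)
  ultimately show ?thesis
    by blast
qed

end

section \<open>Primitive idempotents\<close>

context finite_comm_group
begin

text \<open>Moves primitivity from the algebra of \<open>H\<close> to that of \<open>G\<close>,
  where all computations take place. Centrality is automatic, and the last claim is minimality: an
  idempotent below \<open>e\<close> is \<open>0\<close> or \<open>e\<close>.\<close>

lemma primitive_idempotentD:
  assumes H: "subgroup H G"
    and prim: "primitive_central_idempotent (rat_group_algebra (G\<lparr>carrier := H\<rparr>)) e"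
  shows "e \<in> carrier \<rat>G" "\<And>g. g \<notin> H \<Longrightarrow> e g = 0" "e \<star> e = e" "e \<noteq> (\<lambda>g. 0)"
    and "\<And>u. \<lbrakk>u \<in> carrier \<rat>G; \<And>g. g \<notin> H \<Longrightarrow> u g = 0; u \<star> u = u; u \<star> e = u\<rbrakk> \<Longrightarrow> u = (\<lambda>g. 0) \<or> u = e"
proof -
  let ?R = "rat_group_algebra (G\<lparr>carrier := H\<rparr>)"
  have HG: "H \<subseteq> carrier G"
    using H by (rule subgroup.subset)
  have mem: "f \<in> carrier ?R \<longleftrightarrow> f \<in> carrier \<rat>G \<and> (\<forall>g. g \<notin> H \<longrightarrow> f g = 0)" for f
    using HG by (auto simp: rat_group_algebra_def)
  have ops: "f \<otimes>\<^bsub>?R\<^esub> h = f \<star> h" "f \<oplus>\<^bsub>?R\<^esub> h = f \<oplus>\<^bsub>\<rat>G\<^esub> h" "\<zero>\<^bsub>?R\<^esub> = (\<lambda>g. 0)" "\<zero>\<^bsub>\<rat>G\<^esub> = (\<lambda>g. 0)" for f h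
    by (simp_all add: rat_group_algebra_def)
  have central: "central_idempotent ?R f \<longleftrightarrow> f \<in> carrier ?R \<and> f \<star> f = f" for f
    by (auto simp: central_idempotent_def ops mem intro: conv_comm)
  show e: "e \<in> carrier \<rat>G" "\<And>g. g \<notin> H \<Longrightarrow> e g = 0" "e \<star> e = e" "e \<noteq> (\<lambda>g. 0)"
    using prim by (auto simp: primitive_central_idempotent_def central mem ops)
  fix u assume u: "u \<in> carrier \<rat>G" "\<And>g. g \<notin> H \<Longrightarrow> u g = 0" "u \<star> u = u" "u \<star> e = u"
  \<comment> \<open>The complement of \<open>u\<close> in \<open>e\<close>; it is an idempotent
    orthogonal to \<open>u\<close>, so primitivity applies to \<open>e = u + v\<close>.\<close>
  define v where "v = e \<ominus>\<^bsub>\<rat>G\<^esub> u"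
  have v: "v \<in> carrier \<rat>G"
    using e u by (simp add: v_def)
  have eu: "e \<star> u = u"
    using u e conv_comm by metis
  have vH: "v g = 0" if "g \<notin> H" for g
    using e(1) e(2)[OF that] u(1) u(2)[OF that] by (simp add: v_def minus_apply)
  have uv: "u \<star> v = \<zero>\<^bsub>\<rat>G\<^esub>"
  proof -
    have "u \<star> v = u \<star> e \<ominus>\<^bsub>\<rat>G\<^esub> u \<star> u"
      unfolding v_def using e(1) u(1) by algebra
    then show ?thesis
      using u by simp
  qed
  have "v \<star> v = e \<star> v \<ominus>\<^bsub>\<rat>G\<^esub> u \<star> v"
    unfolding v_def using e(1) u(1) by algebra
  moreover have "e \<star> v = e \<star> e \<ominus>\<^bsub>\<rat>G\<^esub> e \<star> u"
    unfolding v_def using e(1) u(1) by algebra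
  ultimately have "v \<star> v = v"
    using uv e u eu v by (simp add: QG.minus_eq) (simp add: v_def QG.minus_eq)
  moreover have "e = u \<oplus>\<^bsub>\<rat>G\<^esub> v"
    unfolding v_def using e(1) u(1) by algebra
  ultimately have "u = (\<lambda>g. 0) \<or> v = (\<lambda>g. 0)"
    using prim u v vH uv unfolding primitive_central_idempotent_def central mem ops by blast
  moreover have "u = e" if "v = (\<lambda>g. 0)"
    using that \<open>e = u \<oplus>\<^bsub>\<rat>G\<^esub> v\<close> by (auto simp: fun_eq_iff add_apply)
  ultimately show "u = (\<lambda>g. 0) \<or> u = e"
    by blast
qed

end

text \<open>Here \<open>H\<close> plays the part of \<open>G\<^sub>l\<close>, but any subgroup is
  allowed; the long presentation enters only when \<open>z\<close> is chosen.\<close>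

locale primitive_idempotent = finite_comm_group +
  fixes H :: "'a set" and p n :: nat and e :: "'a \<Rightarrow> rat"
  assumes p: "prime p"
    and p_pow: "\<And>g. g \<in> carrier G \<Longrightarrow> g [^] (p ^ n :: nat) = \<one>"
    and H: "subgroup H G"
    and prim: "primitive_central_idempotent (rat_group_algebra (G\<lparr>carrier := H\<rparr>)) e"
begin

lemmas e_mem = primitive_idempotentD(1)[OF H prim]
  and e_outside = primitive_idempotentD(2)[OF H prim]
  and e_idem = primitive_idempotentD(3)[OF H prim]
  and e_nonzero = primitive_idempotentD(4)[OF H prim]
  and e_primitive = primitive_idempotentD(5)[OF H prim]

section \<open>Consequences of primitivity for the stabilizer of \<open>e\<close>\<close>

lemma H_carrier: "y \<in> H \<Longrightarrow> y \<in> carrier G"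
  using H by (rule subgroup.mem_carrier)

lemma p_gt_0: "p > 0"
  using p by (simp add: prime_gt_0_nat)

text \<open>The product is an idempotent below \<open>e\<close>, hence \<open>0\<close> or
  \<open>e\<close>; it is fixed by \<open>y\<close>, whereas \<open>e\<close> is not.\<close>

lemma e_elem_annihilates:
  assumes y: "y \<in> H" "y \<notin> stab e" "y [^] p \<in> stab e"
  shows "e_elem G p y \<star> e = (\<lambda>g. 0)"
proof -
  let ?E = "e_elem G p y" and ?u = "e_elem G p y \<star> e"
  have yc: "y \<in> carrier G"
    using y(1) by (rule H_carrier)
  have E: "?E \<in> carrier \<rat>G"
    using yc by (rule e_elem_mem)
  have u: "?u \<in> carrier \<rat>G"
    using E e_mem by (rule conv_mem)
  have yu: "y \<in> stab ?u"
    using yc e_mem y(3) by (rule stab_e_elem_conv)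
  have outside: "?u g = 0" if "g \<notin> H" for g
  proof (cases "g \<in> carrier G")
    case True
    have "g \<otimes> inv (y [^] k) \<notin> H" for k :: nat
      using that True y(1) subgroup_mult_left_iff[OF H, of "inv (y [^] k)" g]
      by (auto intro: subgroup.m_inv_closed[OF H] subgroup_pow[OF H])
    then show ?thesis
      using True yc e_mem by (simp add: e_elem_conv e_outside)
  qed (use E e_mem in \<open>simp add: conv_outside\<close>)
  have ue: "?u \<star> e = ?u"
    using E e_mem by (simp add: conv_assoc e_idem)
  \<comment> \<open>Idempotence of \<open>?u\<close> does not come from \<open>?E\<close>, which may
    fail to be idempotent, but from \<open>y\<close> fixing \<open>?u\<close>.\<close>
  have "?u \<star> ?u = ?E \<star> (?u \<star> e)"
    using E e_mem by (simp add: QG.m_ac)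
  also have "\<dots> = ?u"
    unfolding ue using yu u p_gt_0 by (rule e_elem_conv_stab)
  finally have "?u = (\<lambda>g. 0) \<or> ?u = e"
    using u outside ue by (intro e_primitive)
  then show ?thesis
    using yu y(2) by auto
qed

text \<open>The previous lemma read at the coefficient of \<open>g\<close>, with
  \<open>inv y\<close> in place of \<open>y\<close> so that positive powers appear.\<close>

lemma sum_translates_eq_0:
  assumes y: "y \<in> H" "y \<notin> stab e" "y [^] p \<in> stab e" and g: "g \<in> carrier G"
  shows "(\<Sum>j<p. e (g \<otimes> y [^] j)) = 0"
proof -
  have yc: "y \<in> carrier G"
    using y(1) by (rule H_carrier)
  have "inv y \<notin> stab e"
    using y(2) yc subgroup.m_inv_closed[OF subgroup_stab, of "inv y" e] by auto
  moreover have "inv y [^] p \<in> stab e"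
    using subgroup.m_inv_closed[OF subgroup_stab y(3)] yc by (simp add: nat_pow_inv)
  ultimately have "(e_elem G p (inv y) \<star> e) g = 0"
    using y(1) subgroup.m_inv_closed[OF H] by (simp add: e_elem_annihilates)
  then show ?thesis
    using yc g e_mem p_gt_0 by (simp add: e_elem_conv nat_pow_inv)
qed

text \<open>
  If \<open>y\<close> and \<open>z\<close> spanned a rank two elementary abelian section, summing \<open>sum_translates_eq_0\<close>
  over the lines through the points \<open>z y\<^sup>k\<close> would give \<open>p e = 0\<close>.
\<close>

lemma order_p_section_unique:
  assumes y: "y \<in> H" "y \<notin> stab e" "y [^] p \<in> stab e"
    and z: "z \<in> H" "z [^] p \<in> stab e"
  shows "\<exists>i<p. z \<otimes> y [^] i \<in> stab e"
proof (rule ccontr)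
  assume neg: "\<not> (\<exists>i<p. z \<otimes> y [^] i \<in> stab e)"
  have c: "y \<in> carrier G" "z \<in> carrier G"
    using y(1) z(1) by (auto intro: H_carrier)
  have "e g = 0" if g: "g \<in> carrier G" for g
  proof -
    \<comment> \<open>The sum along the line in direction \<open>z \<otimes> y [^] k\<close>, which
      by assumption is not in the stabilizer.\<close>
    have line: "(\<Sum>j<p. e (g \<otimes> z [^] j \<otimes> y [^] (j * k))) = 0" if k: "k < p" for k
    proof -
      have "(z \<otimes> y [^] k) [^] j = z [^] j \<otimes> y [^] (j * k)" for j :: nat
        using c by (simp add: nat_pow_distrib nat_pow_pow mult.commute)
      then have eq: "g \<otimes> (z \<otimes> y [^] k) [^] j = g \<otimes> z [^] j \<otimes> y [^] (j * k)" for j :: nat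
        using c g by (simp add: m_assoc)
      have "(z \<otimes> y [^] k) [^] p = z [^] p \<otimes> (y [^] p) [^] k"
        using c by (simp add: nat_pow_distrib nat_pow_pow mult.commute)
      then have "(z \<otimes> y [^] k) [^] p \<in> stab e"
        using y(3) z(2) subgroup_stab by (simp add: subgroup.m_closed subgroup_pow)
      moreover have "z \<otimes> y [^] k \<in> H"
        using y(1) z(1) H by (simp add: subgroup.m_closed subgroup_pow)
      ultimately show ?thesis
        using sum_translates_eq_0[of "z \<otimes> y [^] k" g] neg k g by (auto simp: eq)
    qed
    \<comment> \<open>Summed over \<open>k\<close> first, each \<open>j \<noteq> 0\<close> gives a
      full line in direction \<open>y [^] j\<close>, hence zero; \<open>j = 0\<close> gives
      \<open>p\<close> copies of \<open>e g\<close>.\<close>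
    have "(\<Sum>j<p. \<Sum>k<p. e (g \<otimes> z [^] j \<otimes> y [^] (j * k))) =
      (\<Sum>j<p. if j = 0 then of_nat p * e g else 0)"
    proof (rule sum.cong[OF refl])
      fix j assume j: "j \<in> {..<p}"
      show "(\<Sum>k<p. e (g \<otimes> z [^] j \<otimes> y [^] (j * k))) = (if j = 0 then of_nat p * e g else 0)"
      proof (cases "j = 0")
        case True
        then show ?thesis
          using g by simp
      next
        case False
        have "y [^] j \<notin> stab e"
          by (rule prime_pow_notin_subgroup[OF subgroup_stab p]) (use c y j False in auto)
        moreover have "(y [^] j) [^] p \<in> stab e"
          using subgroup_pow[OF subgroup_stab y(3), of j] c by (simp add: nat_pow_pow mult.commute)
        moreover have "y [^] j \<in> H"
          using y(1) by (rule subgroup_pow[OF H])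
        ultimately show ?thesis
          using sum_translates_eq_0[of "y [^] j" "g \<otimes> z [^] j"] g c False by (simp add: nat_pow_pow)
      qed
    qed
    also have "\<dots> = of_nat p * e g"
      using p_gt_0 by simp
    finally have "of_nat p * e g = (\<Sum>j<p. \<Sum>k<p. e (g \<otimes> z [^] j \<otimes> y [^] (j * k)))" ..
    also have "\<dots> = (\<Sum>k<p. \<Sum>j<p. e (g \<otimes> z [^] j \<otimes> y [^] (j * k)))"
      by (rule sum.swap)
    also have "\<dots> = 0"
      by (simp add: line)
    finally show ?thesis
      using p_gt_0 by simp
  qed
  then have "e = (\<lambda>g. 0)"
    by (metis QG_outside e_mem ext)
  with e_nonzero show False ..
qed

section \<open>Support of \<open>e\<close> and its factorization\<close>

lemma e_pow_coprime: "g \<in> carrier G \<Longrightarrow> \<not> p dvd k \<Longrightarrow> e (g [^] (k::nat)) = e g"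
  using idempotent_pow_coprime[OF e_mem e_idem p p_pow] by simp

text \<open>Some power of \<open>g\<close> has order \<open>p\<close> modulo the stabilizer. If it
  is \<open>g\<close> itself, uniqueness of the subgroup of order \<open>p\<close> puts
  \<open>g\<close> in a coset of a power of \<open>z\<close>. Otherwise \<open>e\<close> is constant
  on the translates of \<open>g\<close> by powers of \<open>z\<close>, and their vanishing sum gives
  \<open>e g = 0\<close>.\<close>

lemma support_cosets:
  assumes z: "z \<in> H" "z \<notin> stab e" "z [^] p \<in> stab e"
    and g: "g \<in> carrier G" "e g \<noteq> 0"
  shows "\<exists>i<p. g \<otimes> inv (z [^] i) \<in> stab e"
proof (rule ccontr)
  assume neg: "\<not> (\<exists>i<p. g \<otimes> inv (z [^] i) \<in> stab e)"
  have zc: "z \<in> carrier G"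
    using z(1) by (rule H_carrier)
  have gH: "g \<in> H"
    using g(2) e_outside by auto
  have "\<exists>t. g [^] (p ^ t :: nat) \<in> stab e"
    using p_pow[OF g(1)] subgroup.one_closed[OF subgroup_stab] by metis
  \<comment> \<open>The order of \<open>g\<close> modulo the stabilizer is \<open>p ^ t\<close>; the
    index \<open>i = 0\<close> in \<open>neg\<close> excludes \<open>t = 0\<close>.\<close>
  define t where "t = (LEAST t. g [^] (p ^ t :: nat) \<in> stab e)"
  have t: "g [^] (p ^ t) \<in> stab e"
    unfolding t_def by (rule LeastI_ex) fact
  have t_min: "g [^] (p ^ k) \<notin> stab e" if "k < t" for k
    using not_less_Least that unfolding t_def by blast
  have "g \<otimes> inv (z [^] (0::nat)) \<notin> stab e"
    using neg p_gt_0 by blast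
  then have "t \<noteq> 0"
    using t g(1) by (intro notI) simp
  then obtain k where k: "t = Suc k"
    using not0_implies_Suc by blast
  define y where "y = g [^] (p ^ k)"
  have yc: "y \<in> carrier G" and yH: "y \<in> H"
    using g(1) gH by (auto simp: y_def intro: subgroup_pow[OF H])
  have y: "y \<notin> stab e" "y [^] p \<in> stab e"
    using t_min[of k] t g(1) by (auto simp: k y_def nat_pow_pow mult.commute)
  show False
  proof (cases k)
    case 0
    then have gp: "g [^] p \<in> stab e"
      using y(2) g(1) by (simp add: y_def)
    have "inv z \<notin> stab e"
      using z(2) zc subgroup.m_inv_closed[OF subgroup_stab, of "inv z" e] by auto
    moreover have "inv z [^] p \<in> stab e"
      using subgroup.m_inv_closed[OF subgroup_stab z(3)] zc by (simp add: nat_pow_inv)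
    moreover have "inv z \<in> H"
      using z(1) by (rule subgroup.m_inv_closed[OF H])
    ultimately obtain i where "i < p" "g \<otimes> inv z [^] i \<in> stab e"
      using order_p_section_unique[of "inv z" g] gH gp by blast
    then show False
      using neg zc by (simp add: nat_pow_inv)
  next
    \<comment> \<open>Modulo the stabilizer \<open>z\<close> is a power of
      \<open>y = g [^] (p ^ k)\<close>, so \<open>g \<otimes> z [^] j\<close> is \<open>g\<close> to
      an exponent congruent to \<open>1\<close> modulo \<open>p\<close>.\<close>
    case (Suc k')
    have "inv y \<notin> stab e"
      using y(1) yc subgroup.m_inv_closed[OF subgroup_stab, of "inv y" e] by auto
    moreover have "inv y [^] p \<in> stab e"
      using subgroup.m_inv_closed[OF subgroup_stab y(2)] yc by (simp add: nat_pow_inv)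
    moreover have "inv y \<in> H"
      using yH by (rule subgroup.m_inv_closed[OF H])
    ultimately obtain i :: nat where i: "z \<otimes> inv y [^] i \<in> stab e"
      using order_p_section_unique[of "inv y" z] z by blast
    have "e (g \<otimes> z [^] j) = e g" for j :: nat
    proof -
      have zeq: "z = y [^] i \<otimes> (z \<otimes> inv y [^] i)"
        using zc yc by (simp add: nat_pow_inv m_lcomm[of "y [^] i"])
      have "z [^] j = (y [^] i) [^] j \<otimes> (z \<otimes> inv y [^] i) [^] j"
        by (subst zeq, rule nat_pow_distrib) (use zc yc in auto)
      then have "g \<otimes> z [^] j = g \<otimes> (y [^] i) [^] j \<otimes> (z \<otimes> inv y [^] i) [^] j"
        using zc yc g(1) by (simp add: m_assoc)
      also have "g \<otimes> (y [^] i) [^] j = g [^] (1 + p ^ k * i * j)"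
        using g(1) by (simp only: y_def nat_pow_pow nat_pow_mult[symmetric] nat_pow_eone)
      finally have "e (g \<otimes> z [^] j) = e (g [^] (1 + p ^ k * i * j))"
        using stabD[OF subgroup_pow[OF subgroup_stab i]] g(1) by simp
      moreover have "\<not> p dvd 1 + p ^ k * i * j"
      proof -
        have "p dvd p ^ k * i * j"
          by (simp add: Suc)
        then show ?thesis
          using p by (metis dvd_add_left_iff not_prime_unit)
      qed
      ultimately show ?thesis
        using g(1) e_pow_coprime by metis
    qed
    then have "of_nat p * e g = (\<Sum>j<p. e (g \<otimes> z [^] j))"
      by simp
    also have "\<dots> = 0"
      using z g(1) by (rule sum_translates_eq_0)
    finally show False
      using p_gt_0 g(2) by simp
  qed
qed

text \<open>With \<open>K = H \<inter> stab e\<close>, \<open>e\<close> is supported on the cosets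
  of \<open>K\<close> by powers of \<open>z\<close> and takes one value on \<open>K\<close> and one
  on the other \<open>p - 1\<close> cosets. So \<open>e\<close> is a combination of \<open>P\<close>
  and \<open>E \<star> P\<close>, and \<open>E \<star> e = 0\<close> leaves a multiple of
  \<open>E' \<star> P\<close>.\<close>

lemma eq_product:
  assumes z: "z \<in> H" "z \<notin> stab e" "z [^] p \<in> stab e"
  shows "\<exists>xs. set xs \<subseteq> H \<and> e = list_product \<rat>G (e'_elem G p z # map (e_elem G p) xs)"
proof -
  define K where "K = H \<inter> stab e"
  have K: "subgroup K G"
    unfolding K_def using H subgroup_stab by (rule subgroups_Inter_pair)
  have KC: "K \<subseteq> carrier G"
    using K by (rule subgroup.subset)
  have zc: "z \<in> carrier G"
    using z(1) by (rule H_carrier)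
  have zK: "z \<notin> K" "z [^] p \<in> K"
    using z subgroup_pow[OF H z(1)] by (auto simp: K_def)
  obtain xs where xs: "set xs \<subseteq> K" "K \<subseteq> stab (e_prod p xs)"
    using exists_e_prod_stab[OF K, of p n] p_pow KC by blast
  define P where "P = e_prod p xs"
  define E where "E = e_elem G p z"
  define E' where "E' = e'_elem G p z"
  define c where "c = P \<one>"
  \<comment> \<open>The values of \<open>e\<close> on \<open>K\<close> and on each coset of
    \<open>z [^] i\<close> with \<open>0 < i < p\<close>.\<close>
  define a b where "a = e \<one>" and "b = e z"
  have P: "P \<in> carrier \<rat>G"
    unfolding P_def using xs(1) KC by (intro e_prod_mem) auto
  have E: "E \<in> carrier \<rat>G"
    unfolding E_def using zc by (rule e_elem_mem)
  have E'_def': "E' = \<one>\<^bsub>\<rat>G\<^esub> \<ominus>\<^bsub>\<rat>G\<^esub> E"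
    by (simp add: E'_def E_def e'_elem_def)
  then have E': "E' \<in> carrier \<rat>G"
    using E by simp
  have E'_conv: "(E' \<star> f) g = f g - (E \<star> f) g" if f: "f \<in> carrier \<rat>G" for f g
  proof -
    have "E' \<star> f = f \<ominus>\<^bsub>\<rat>G\<^esub> E \<star> f"
      unfolding E'_def' using E f by algebra
    then show ?thesis
      using E f by (simp add: minus_apply)
  qed
  have Pe: "P \<star> e = e"
    unfolding P_def using xs(1) by (intro e_prod_conv_stab) (auto simp: K_def e_mem p_gt_0)
  have Ee: "E \<star> e = (\<lambda>g. 0)"
    unfolding E_def using z by (rule e_elem_annihilates)
  have P_apply: "P g = (if g \<in> K then c else 0)" if g: "g \<in> carrier G" for g
  proof (cases "g \<in> K")
    case True
    then have "P (\<one> \<otimes> g) = P \<one>"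
      using xs(2) by (intro stabD) (auto simp: P_def)
    then show ?thesis
      using True g by (simp add: c_def)
  qed (use e_prod_outside[OF K xs(1)] g in \<open>simp add: P_def\<close>)
  have c0: "c \<noteq> 0"
  proof
    assume "c = 0"
    then have "P = \<zero>\<^bsub>\<rat>G\<^esub>"
      using P_apply P by (intro QG_eqI) (auto simp: zero_apply)
    then have "e = \<zero>\<^bsub>\<rat>G\<^esub>"
      using Pe e_mem by simp
    with e_nonzero show False
      by (auto simp: zero_apply)
  qed
  have coset_unique: "j = i"
    if i: "i < p" "g \<otimes> inv (z [^] i) \<in> K" and j: "j < p" "g \<otimes> inv (z [^] j) \<in> K"
      and g: "g \<in> carrier G" for i j :: nat and g
  proof -
    have *: False if ij: "i < j" "j < p" "g \<otimes> inv (z [^] i) \<in> K" "g \<otimes> inv (z [^] j) \<in> K" for i j :: nat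
    proof -
      have "z [^] j = z [^] i \<otimes> z [^] (j - i)"
        using zc ij(1) by (simp add: nat_pow_mult)
      then have "g \<otimes> inv (z [^] j) = inv (z [^] (j - i)) \<otimes> (g \<otimes> inv (z [^] i))"
        using zc g by (simp add: inv_mult_group m_lcomm)
      then have "inv (z [^] (j - i)) \<in> K"
        using ij(3,4) zc subgroup_mult_left_iff[OF K ij(3)] by simp
      then have "z [^] (j - i) \<in> K"
        using subgroup.m_inv_closed[OF K, of "inv (z [^] (j - i))"] zc by simp
      then show False
        using prime_pow_notin_subgroup[OF K p zc zK, of "j - i"] ij by simp
    qed
    show ?thesis
      using *[of i j] *[of j i] i j by (cases i j rule: linorder_cases) auto
  qed
  have EP_apply: "(E \<star> P) g = (\<Sum>j<p. P (g \<otimes> inv (z [^] j))) / of_nat p" if "g \<in> carrier G" for g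
    unfolding E_def using zc P that by (rule e_elem_conv)
  \<comment> \<open>On the \<open>p\<close> cosets \<open>E \<star> P\<close> is constantly
    \<open>c / p\<close>; the second term thus supplies \<open>b\<close> everywhere there and the
    first corrects the value on \<open>K\<close> to \<open>a\<close>.\<close>
  have e_apply: "e g = (a - b) / c * P g + of_nat p * b / c * (E \<star> P) g" if g: "g \<in> carrier G" for g
  proof (cases "\<exists>i<p. g \<otimes> inv (z [^] i) \<in> K")
    case True
    then obtain i where i: "i < p" "g \<otimes> inv (z [^] i) \<in> K"
      by blast
    have coset_iff: "g \<otimes> inv (z [^] j) \<in> K \<longleftrightarrow> j = i" if "j < p" for j
      using coset_unique[OF i that _ g] i(2) by blast
    have "(\<Sum>j<p. P (g \<otimes> inv (z [^] j))) = (\<Sum>j<p. if j = i then c else 0)"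
      using zc g by (intro sum.cong) (simp_all add: P_apply coset_iff)
    then have EP: "of_nat p * (E \<star> P) g = c"
      using i(1) g by (simp add: EP_apply)
    have "z [^] i \<otimes> (g \<otimes> inv (z [^] i)) = g"
      using g zc by (simp add: m_lcomm)
    then have eg: "e g = e (z [^] i)"
      using stabD[of "g \<otimes> inv (z [^] i)" e "z [^] i"] i(2) zc by (simp add: K_def)
    show ?thesis
    proof (cases "i = 0")
      case True
      then have "P g = c"
        using i(2) g by (simp add: P_apply)
      then show ?thesis
        using eg True EP c0 by (simp add: a_def field_simps)
    next
      case False
      then have "g \<notin> K"
        using coset_iff[OF p_gt_0] g by simp
      then have "P g = 0"
        using g by (simp add: P_apply)
      moreover have "e g = b"
        using eg e_pow_coprime[OF zc, of i] False i(1) by (simp add: b_def nat_dvd_not_less)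
      ultimately show ?thesis
        using EP c0 by (simp add: field_simps)
    qed
  next
    case False
    then have "P (g \<otimes> inv (z [^] j)) = 0" if "j < p" for j
      using that g zc by (auto simp: P_apply)
    then have 1: "(E \<star> P) g = 0"
      using g by (simp add: EP_apply)
    have "g \<otimes> inv (z [^] (0::nat)) \<notin> K"
      using False p_gt_0 by blast
    then have 2: "P g = 0"
      using g by (simp add: P_apply)
    have "e g = 0"
    proof (rule ccontr)
      assume ne: "e g \<noteq> 0"
      then obtain i where i: "i < p" "g \<otimes> inv (z [^] i) \<in> stab e"
        using support_cosets[OF z g] by blast
      have "g \<in> H"
        using ne e_outside by auto
      then have "g \<otimes> inv (z [^] i) \<in> H"
        using z(1) H by (simp add: subgroup.m_closed subgroup.m_inv_closed subgroup_pow)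
      then show False
        using False i by (auto simp: K_def)
    qed
    then show ?thesis
      using 1 2 by simp
  qed
  define \<alpha> \<beta> where "\<alpha> = (a - b) / c" and "\<beta> = of_nat p * b / c"
  have EP: "E \<star> P \<in> carrier \<rat>G"
    using E P by (rule conv_mem)
  have e_eq: "e = (\<lambda>g. \<alpha> * P g) \<oplus>\<^bsub>\<rat>G\<^esub> (\<lambda>g. \<beta> * (E \<star> P) g)"
  proof (rule QG_eqI)
    show "(\<lambda>g. \<alpha> * P g) \<oplus>\<^bsub>\<rat>G\<^esub> (\<lambda>g. \<beta> * (E \<star> P) g) \<in> carrier \<rat>G"
      using P EP by (intro QG.a_closed scale_mem)
  qed (use e_mem in \<open>simp_all add: e_apply add_apply \<alpha>_def \<beta>_def\<close>)
  have "z [^] p \<in> stab P"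
    using xs(2) zK(2) by (auto simp: P_def)
  then have "z \<in> stab (E \<star> P)"
    unfolding E_def using zc P by (intro stab_e_elem_conv)
  then have EEP: "E \<star> (E \<star> P) = E \<star> P"
    unfolding E_def using EP p_gt_0 by (intro e_elem_conv_stab) (auto simp: E_def)
  have "E \<star> e = E \<star> (\<lambda>g. \<alpha> * P g) \<oplus>\<^bsub>\<rat>G\<^esub> E \<star> (\<lambda>g. \<beta> * (E \<star> P) g)"
    by (subst e_eq) (use E P EP scale_mem in \<open>auto intro: QG.r_distr\<close>)
  also have "\<dots> = (\<lambda>g. (\<alpha> + \<beta>) * (E \<star> P) g)"
    using E P EP by (auto simp: conv_scale_right EEP add_apply ring_distribs)
  finally have "(\<alpha> + \<beta>) * (E \<star> P) g = 0" for g
    using Ee by metis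
  \<comment> \<open>The relation is used at each coefficient, without cancelling
    \<open>E \<star> P\<close>.\<close>
  then have \<beta>: "\<beta> * (E \<star> P) g = - \<alpha> * (E \<star> P) g" for g
    by (simp add: ring_distribs eq_neg_iff_add_eq_0 add.commute)
  have scalar: "e = (\<lambda>g. \<alpha> * (E' \<star> P) g)"
    by (subst e_eq) (auto simp: add_apply \<beta> E'_conv P ring_distribs)
  have "E' \<star> P \<star> e = E' \<star> e"
    using E' P e_mem by (simp add: conv_assoc Pe)
  also have "\<dots> = e"
    using E'_conv[OF e_mem] Ee by auto
  finally have fe: "E' \<star> P \<star> e = e" .
  \<comment> \<open>Multiplying by \<open>e\<close>, on which \<open>E' \<star> P\<close> acts as
    the identity, determines the scalar.\<close>
  have "e = (\<lambda>g. \<alpha> * (E' \<star> P) g) \<star> e"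
    using e_idem scalar by simp
  also have "\<dots> = (\<lambda>g. \<alpha> * e g)"
    using conv_scale_left[OF conv_mem[OF E' P] e_mem] fe by simp
  finally have "\<alpha> * e g = e g" for g
    by metis
  then have "\<alpha> = 1"
    using e_nonzero by (auto simp: fun_eq_iff)
  then have "e = E' \<star> P"
    using scalar by simp
  then have "e = list_product \<rat>G (E' # map (e_elem G p) xs)"
    by (simp add: list_product_simps P_def)
  then show ?thesis
    using xs(1) unfolding E'_def K_def by blast
qed

end

text \<open>Invariance makes \<open>e\<close> a constant \<open>c\<close> on \<open>H\<close>; the
  coefficient of the identity in \<open>e \<star> e = e\<close> gives \<open>c = |H| c^2\<close>,
  and \<open>c\<close> is nonzero.\<close>

lemma (in finite_comm_group) invariant_idempotent_trivial:
  assumes H: "subgroup H G"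
    and e: "e \<in> carrier \<rat>G" "\<And>g. g \<notin> H \<Longrightarrow> e g = 0" "e \<star> e = e" "e \<noteq> (\<lambda>g. 0)"
    and inv: "H \<subseteq> stab e"
  shows "e = trivial_idempotent H"
proof -
  define c where "c = e \<one>"
  have HG: "H \<subseteq> carrier G"
    using H by (rule subgroup.subset)
  have fin: "finite H"
    using HG finite_carrier by (rule finite_subset)
  have e_apply: "e g = (if g \<in> H then c else 0)" for g
    using stabD[of g e \<one>] inv HG e(2) by (auto simp: c_def subset_iff)
  have "c = (e \<star> e) \<one>"
    by (simp add: c_def e(3))
  also have "\<dots> = (\<Sum>b\<in>carrier G. e (inv b) * e b)"
    using e(1) by (simp add: conv_apply)
  also have "\<dots> = (\<Sum>b\<in>carrier G. if b \<in> H then c * c else 0)"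
    using subgroup.m_inv_closed[OF H] by (intro sum.cong) (auto simp: e_apply)
  also have "\<dots> = of_nat (card H) * (c * c)"
    using HG finite_carrier by (simp add: sum.inter_restrict[symmetric] Int_absorb1)
  finally have "c = of_nat (card H) * (c * c)" .
  moreover have "c \<noteq> 0"
    using e(4) e_apply by auto
  ultimately have "c * of_nat (card H) = 1"
    by (simp add: mult.commute)
  then have "c = 1 / of_nat (card H)"
    by (auto simp: eq_divide_eq)
  moreover have "(\<Sum>g\<in>H. group_basis g h) = (if h \<in> H then 1 else 0)" for h
    using fin by (simp add: group_basis_def)
  ultimately show ?thesis
    by (auto simp: trivial_idempotent_def e_apply)
qed

section \<open>Long generators\<close>

lemma set_long_generators:
  "set (long_generators m r s x) = (\<Union>i\<in>{1..m}. \<Union>j\<in>{1..s i}. x i j ` {1..r i})"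
  by (simp add: long_generators_def atLeastLessThanSuc_atLeastAtMost del: upt_Suc)

context long_presentation
begin

lemma gen_pow:
  assumes i: "i \<in> {1..m}" and j: "j \<in> {1..s i}" and a: "1 \<le> a" "a + d \<le> r i"
  shows "x i j (a + d) [^] (p ^ d) = x i j a"
  using a(2)
proof (induction d)
  case 0
  then show ?case
    using gen_closed[OF i j, of a] a(1) by simp
next
  case (Suc d)
  have "x i j (a + Suc d) [^] (p ^ Suc d) = (x i j (a + Suc d) [^] p) [^] (p ^ d)"
    using gen_closed[OF i j, of "a + Suc d"] Suc.prems by (simp add: nat_pow_pow)
  also have "x i j (a + Suc d) [^] p = x i j (a + d)"
    using gen_step[OF i j, of "a + Suc d"] Suc.prems a(1) by simp
  finally show ?case
    using Suc by simp
qed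

text \<open>Descend from \<open>g\<close> through the generators of its cyclic factor to the lowest
  one outside \<open>S\<close>. Its \<open>p\<close>-th power is the generator below it or the
  identity. That \<open>z\<close> is a power of \<open>g\<close> will keep it inside
  \<open>G\<^sub>l\<close>.\<close>

lemma exists_generator_order_p_modulo:
  assumes S: "subgroup S G" and g: "g \<in> set (long_generators m r s x)" "g \<notin> S"
  shows "\<exists>z \<in> set (long_generators m r s x). \<exists>k::nat. z = g [^] k \<and> z \<notin> S \<and> z [^] p \<in> S"
proof -
  obtain i j a where ij: "i \<in> {1..m}" "j \<in> {1..s i}" and a: "1 \<le> a" "a \<le> r i" and g_eq: "g = x i j a"
    using g(1) by (auto simp: set_long_generators)
  define b where "b = (LEAST b. 1 \<le> b \<and> x i j b \<notin> S)"
  have b: "1 \<le> b \<and> x i j b \<notin> S" and "b \<le> a"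
    using LeastI[of "\<lambda>b. 1 \<le> b \<and> x i j b \<notin> S" a] Least_le[of "\<lambda>b. 1 \<le> b \<and> x i j b \<notin> S" a]
      a g(2) g_eq by (auto simp: b_def)
  have min: "x i j c \<in> S" if "1 \<le> c" "c < b" for c
    using not_less_Least[of c "\<lambda>b. 1 \<le> b \<and> x i j b \<notin> S"] that by (auto simp: b_def)
  have "x i j b [^] p \<in> S"
  proof (cases "b = 1")
    case True
    then show ?thesis
      using gen_bottom[OF ij] subgroup.one_closed[OF S] by simp
  next
    case False
    then have "1 \<le> b - 1" "b - 1 < b" "b \<in> {2..r i}"
      using b \<open>b \<le> a\<close> a by auto
    then show ?thesis
      using gen_step[OF ij, of b] min by metis
  qed
  moreover have "x i j b = g [^] (p ^ (a - b))"
    using gen_pow[OF ij, of b "a - b"] b \<open>b \<le> a\<close> a g_eq by simp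
  moreover have "x i j b \<in> set (long_generators m r s x)"
    unfolding set_long_generators
    by (intro UN_I[OF ij(1)] UN_I[OF ij(2)] imageI) (use b \<open>b \<le> a\<close> a in auto)
  ultimately show ?thesis
    using b by blast
qed

end

theorem mainTheorem4:
  fixes G :: "('a, 'b) monoid_scheme" (structure)
    and p m l :: nat and r s :: "nat \<Rightarrow> nat"
    and x :: "nat \<Rightarrow> nat \<Rightarrow> nat \<Rightarrow> 'a"
    and e :: "'a \<Rightarrow> rat"
  defines "gens \<equiv> long_generators m r s x"
    and "Gl \<equiv> series_subgroup G (long_generators m r s x) l"
  assumes "prime p"
    and "comm_group G" and "finite (carrier G)" and "\<exists>n. order G = p ^ n"
    and "long_presentation G p m r s x"
    and "l \<le> length gens"
    and "primitive_central_idempotent (rat_group_algebra (G\<lparr>carrier := Gl\<rparr>)) e"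
    and "e \<noteq> trivial_idempotent Gl"
  shows "\<exists>z xs. z \<in> set gens \<and> z \<in> Gl \<and> set xs \<subseteq> Gl \<and>
           e = list_product (rat_group_algebra G) (e'_elem G p z # map (e_elem G p) xs)"
proof -
  interpret finite_comm_group G
    by (intro finite_comm_group.intro finite_comm_group_axioms.intro) fact+
  interpret long_presentation G p m r s x by fact
  obtain n where n: "order G = p ^ n"
    using assms by blast
  have p_pow: "g [^] (p ^ n) = \<one>" if "g \<in> carrier G" for g
    using pow_order_eq_1[OF that] n by simp
  have take: "set (take l gens) \<subseteq> set gens" "set gens \<subseteq> carrier G"
    using gen_closed by (auto simp: gens_def set_long_generators dest: in_set_takeD)
  have Gl: "subgroup Gl G"
    unfolding Gl_def series_subgroup_def using take unfolding gens_def by (intro generate_is_subgroup) blast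
  interpret primitive_idempotent G Gl p n e
    by (intro primitive_idempotent.intro primitive_idempotent_axioms.intro finite_comm_group_axioms)
      (fact \<open>prime p\<close> p_pow Gl assms)+
  \<comment> \<open>Non-triviality of \<open>e\<close> enters here; since \<open>Gl\<close> is
    generated by long generators, one of them must fail to fix \<open>e\<close>.\<close>
  have "\<not> Gl \<subseteq> stab e"
    using invariant_idempotent_trivial[OF Gl e_mem e_outside e_idem e_nonzero] \<open>e \<noteq> trivial_idempotent Gl\<close> by blast
  then have "\<not> set (take l gens) \<subseteq> stab e"
    using generate_subgroup_incl[OF _ subgroup_stab] unfolding Gl_def series_subgroup_def gens_def by blast
  then obtain g where g: "g \<in> set (take l gens)" "g \<notin> stab e"
    by blast
  then have gGl: "g \<in> Gl"
    unfolding Gl_def series_subgroup_def gens_def by (simp add: generate.incl)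
  obtain z and k :: nat where z: "z \<in> set gens" "z = g [^] k" "z \<notin> stab e" "z [^] p \<in> stab e"
    using exists_generator_order_p_modulo[OF subgroup_stab, of g e] g take unfolding gens_def by blast
  have zGl: "z \<in> Gl"
    using z(2) subgroup_pow[OF Gl gGl] by simp
  obtain xs where "set xs \<subseteq> Gl" "e = list_product \<rat>G (e'_elem G p z # map (e_elem G p) xs)"
    using eq_product[OF zGl z(3,4)] by blast
  with z(1) zGl show ?thesis
    by blast
qed

end
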